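(* Suppose the underlying classical logic is undecidable, i.e., there is no algorithm deciding, for a given sentence $\psi$, whether $\vdash\psi$. Then no weighing $\mathcal{W}$ that satisfies both HP and EP is computable.
   Context: The underlying logic is classical (propositional or first-order) logic over a fixed countable, effectively presented language, with the usual effective notion of proof (so the set of provable sentences is recursively enumerable, and negation is a computable operation on sentences). A theory is a set of sentences. $T\vdash U$ means $T$ proves every sentence in $U$; $T\equiv U$ means $T\vdash U$ and $U\vdash T$. A weighing is a mapping $\mathcal{W}$ from theories to real numbers. It satisfies HP if for all theories $T,U$, $\mathcal{W}(U)>\mathcal{W}(T)$ implies $T\nvdash U$. It satisfies EP if for all theories $T,U$, $\mathcal{W}(T)=\mathcal{W}(U)$ implies $T\equiv U$. A weighing is computable if its values on finite theories are computable uniformly from the theory: there is an algorithm which, given a finite theory $T$ and $k\in\mathbb{N}$, outputs a rational number within $2^{-k}$ of $\mathcal{W}(T)$. *)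

theory Defs
  imports Complex_Main "HOL-Library.Nat_Bijection" "HOL-Library.Countable"
begin

section \<open>Algorithms: partial recursive functions\<close>

datatype recf =
    Zero
  | Succ
  | Proj nat
  | Comp recf "recf list"
  | PrimRec recf recf
  | Mu recf

text \<open>\<open>eval e xs y\<close>: the program \<open>e\<close> halts on the input tuple \<open>xs\<close> with output \<open>y\<close>.
  Arities are implicit; a program undefined on tuples of a given length simply has no value there.\<close>

inductive eval :: "recf \<Rightarrow> nat list \<Rightarrow> nat \<Rightarrow> bool" where
  Zero: "eval Zero xs 0"
| Succ: "eval Succ [x] (Suc x)"
| Proj: "i < length xs \<Longrightarrow> eval (Proj i) xs (xs ! i)"
| Comp: "list_all2 (\<lambda>g y. eval g xs y) gs ys \<Longrightarrow> eval f ys z \<Longrightarrow> eval (Comp f gs) xs z"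
| PrimRec_0: "eval f xs y \<Longrightarrow> eval (PrimRec f g) (0 # xs) y"
| PrimRec_Suc: "eval (PrimRec f g) (n # xs) y \<Longrightarrow> eval g (n # y # xs) z
    \<Longrightarrow> eval (PrimRec f g) (Suc n # xs) z"
| Mu: "eval f (n # xs) 0 \<Longrightarrow> (\<forall>i<n. \<exists>y. eval f (i # xs) (Suc y)) \<Longrightarrow> eval (Mu f) xs n"

lemma eval_deterministic:
  assumes "eval e xs y" and "eval e xs z"
  shows "y = z"
  using assms
proof (induction arbitrary: z rule: eval.induct)
  case (Comp xs gs ys f y)
  from Comp.prems obtain zs where zs: "list_all2 (\<lambda>g y. eval g xs y) gs zs" "eval f zs z"
    by cases auto
  have "ys = zs"
    using Comp.IH(1) zs(1) by (auto simp: list_all2_conv_all_nth intro!: nth_equalityI)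
  then show ?case
    using Comp.IH(2) zs(2) by simp
next
  case (PrimRec_Suc f g n xs y y')
  from PrimRec_Suc.prems obtain u where "eval (PrimRec f g) (n # xs) u" "eval g (n # u # xs) z"
    by cases auto
  then show ?case
    using PrimRec_Suc.IH by blast
next
  case (Mu f n xs)
  from Mu.prems have z: "eval f (z # xs) 0" "\<forall>i<z. \<exists>y. eval f (i # xs) (Suc y)"
    by (cases; blast)+
  have "\<not> z < n" "\<not> n < z"
    using Mu.IH z by blast+
  then show ?case
    by simp
qed (erule eval.cases; simp)+

definition decidable_on :: "('a \<Rightarrow> nat) \<Rightarrow> 'a set \<Rightarrow> ('a \<Rightarrow> bool) \<Rightarrow> bool" where
  "decidable_on code D P \<longleftrightarrow> (\<exists>e. \<forall>x\<in>D. eval e [code x] (if P x then 1 else 0))"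


section \<open>Classical propositional and first-order logic\<close>

datatype tm = Var nat | Fn nat "tm list"

datatype fm =
    Bot
  | Pre nat "tm list"
  | Eql tm tm
  | Imp fm fm
  | Forall nat fm

abbreviation Neg :: "fm \<Rightarrow> fm" where
  "Neg \<phi> \<equiv> Imp \<phi> Bot"

text \<open>\<open>Propositional A\<close> is the propositional language with letters \<open>A\<close>.  \<open>FirstOrder F P e\<close> is the
  first-order language with function symbols \<open>F\<close> and predicate symbols \<open>P\<close>, a symbol being a pair
  of a name and an arity (constants are function symbols of arity 0); \<open>e\<close> says whether equality is
  present as a logical symbol.\<close>

datatype language =
    Propositional "nat set"
  | FirstOrder "(nat \<times> nat) set" "(nat \<times> nat) set" bool

fun effectively_presented :: "language \<Rightarrow> bool" where
  "effectively_presented (Propositional A) \<longleftrightarrow> decidable_on id UNIV (\<lambda>p. p \<in> A)"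
| "effectively_presented (FirstOrder F P e) \<longleftrightarrow>
     decidable_on prod_encode UNIV (\<lambda>s. s \<in> F) \<and> decidable_on prod_encode UNIV (\<lambda>s. s \<in> P)"

fun is_term :: "(nat \<times> nat) set \<Rightarrow> tm \<Rightarrow> bool" where
  "is_term F (Var x) \<longleftrightarrow> True"
| "is_term F (Fn f ts) \<longleftrightarrow> (f, length ts) \<in> F \<and> (\<forall>t\<in>set ts. is_term F t)"

fun is_formula :: "language \<Rightarrow> fm \<Rightarrow> bool" where
  "is_formula L Bot \<longleftrightarrow> True"
| "is_formula L (Pre p ts) \<longleftrightarrow>
     (case L of
        Propositional A \<Rightarrow> p \<in> A \<and> ts = []
      | FirstOrder F P e \<Rightarrow> (p, length ts) \<in> P \<and> (\<forall>t\<in>set ts. is_term F t))"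
| "is_formula L (Eql s t) \<longleftrightarrow>
     (case L of
        Propositional A \<Rightarrow> False
      | FirstOrder F P e \<Rightarrow> e \<and> is_term F s \<and> is_term F t)"
| "is_formula L (Imp \<phi> \<psi>) \<longleftrightarrow> is_formula L \<phi> \<and> is_formula L \<psi>"
| "is_formula L (Forall x \<phi>) \<longleftrightarrow>
     (case L of
        Propositional A \<Rightarrow> False
      | FirstOrder F P e \<Rightarrow> is_formula L \<phi>)"

fun fv_tm :: "tm \<Rightarrow> nat set" where
  "fv_tm (Var x) = {x}"
| "fv_tm (Fn f ts) = (\<Union>t\<in>set ts. fv_tm t)"

fun fv :: "fm \<Rightarrow> nat set" where
  "fv Bot = {}"
| "fv (Pre p ts) = (\<Union>t\<in>set ts. fv_tm t)"
| "fv (Eql s t) = fv_tm s \<union> fv_tm t"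
| "fv (Imp \<phi> \<psi>) = fv \<phi> \<union> fv \<psi>"
| "fv (Forall x \<phi>) = fv \<phi> - {x}"

definition sentences :: "language \<Rightarrow> fm set" where
  "sentences L = {\<phi>. is_formula L \<phi> \<and> fv \<phi> = {}}"

fun subst_tm :: "nat \<Rightarrow> tm \<Rightarrow> tm \<Rightarrow> tm" where
  "subst_tm x s (Var y) = (if y = x then s else Var y)"
| "subst_tm x s (Fn f ts) = Fn f (map (subst_tm x s) ts)"

text \<open>\<open>subst x s \<phi>\<close> replaces the free occurrences of \<open>x\<close> in \<open>\<phi>\<close> by \<open>s\<close> without renaming bound
  variables; it is only used when \<open>s\<close> is free for \<open>x\<close> in \<open>\<phi>\<close>.\<close>

fun subst :: "nat \<Rightarrow> tm \<Rightarrow> fm \<Rightarrow> fm" where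
  "subst x s Bot = Bot"
| "subst x s (Pre p ts) = Pre p (map (subst_tm x s) ts)"
| "subst x s (Eql t u) = Eql (subst_tm x s t) (subst_tm x s u)"
| "subst x s (Imp \<phi> \<psi>) = Imp (subst x s \<phi>) (subst x s \<psi>)"
| "subst x s (Forall y \<phi>) = (if y = x then Forall y \<phi> else Forall y (subst x s \<phi>))"

fun free_for :: "tm \<Rightarrow> nat \<Rightarrow> fm \<Rightarrow> bool" where
  "free_for s x (Imp \<phi> \<psi>) \<longleftrightarrow> free_for s x \<phi> \<and> free_for s x \<psi>"
| "free_for s x (Forall y \<phi>) \<longleftrightarrow> x \<notin> fv (Forall y \<phi>) \<or> (y \<notin> fv_tm s \<and> free_for s x \<phi>)"
| "free_for s x _ \<longleftrightarrow> True"

text \<open>A Hilbert calculus.  All axiom instances are formulas of the language, so in a propositional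
  language only \<open>hyp\<close>, \<open>K\<close>, \<open>S\<close>, \<open>DN\<close> and \<open>MP\<close> apply, and the equality axioms are available only
  in languages with equality.  Hypotheses are meant to be sentences, hence generalization is
  unrestricted.\<close>

inductive derives :: "language \<Rightarrow> fm set \<Rightarrow> fm \<Rightarrow> bool" for L :: language and T :: "fm set" where
  hyp: "\<phi> \<in> T \<Longrightarrow> derives L T \<phi>"
| K: "is_formula L \<phi> \<Longrightarrow> is_formula L \<psi> \<Longrightarrow> derives L T (Imp \<phi> (Imp \<psi> \<phi>))"
| S: "is_formula L \<phi> \<Longrightarrow> is_formula L \<psi> \<Longrightarrow> is_formula L \<chi> \<Longrightarrow>
    derives L T (Imp (Imp \<phi> (Imp \<psi> \<chi>)) (Imp (Imp \<phi> \<psi>) (Imp \<phi> \<chi>)))"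
| DN: "is_formula L \<phi> \<Longrightarrow> derives L T (Imp (Neg (Neg \<phi>)) \<phi>)"
| Inst: "is_formula L (Imp (Forall x \<phi>) (subst x t \<phi>)) \<Longrightarrow> free_for t x \<phi> \<Longrightarrow>
    derives L T (Imp (Forall x \<phi>) (subst x t \<phi>))"
| Distr: "is_formula L (Forall x (Imp \<phi> \<psi>)) \<Longrightarrow> x \<notin> fv \<phi> \<Longrightarrow>
    derives L T (Imp (Forall x (Imp \<phi> \<psi>)) (Imp \<phi> (Forall x \<psi>)))"
| Refl: "is_formula L (Eql t t) \<Longrightarrow> derives L T (Eql t t)"
| Leibniz: "is_formula L (Eql s t) \<Longrightarrow> is_formula L \<phi> \<Longrightarrow> free_for s x \<phi> \<Longrightarrow> free_for t x \<phi> \<Longrightarrow>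
    derives L T (Imp (Eql s t) (Imp (subst x s \<phi>) (subst x t \<phi>)))"
| MP: "derives L T (Imp \<phi> \<psi>) \<Longrightarrow> derives L T \<phi> \<Longrightarrow> derives L T \<psi>"
| Gen: "derives L T \<phi> \<Longrightarrow> is_formula L (Forall x \<phi>) \<Longrightarrow> derives L T (Forall x \<phi>)"

fun tm_code :: "tm \<Rightarrow> nat" where
  "tm_code (Var x) = prod_encode (0, x)"
| "tm_code (Fn f ts) = prod_encode (1, prod_encode (f, list_encode (map tm_code ts)))"

fun fm_code :: "fm \<Rightarrow> nat" where
  "fm_code Bot = prod_encode (0, 0)"
| "fm_code (Pre p ts) = prod_encode (1, prod_encode (p, list_encode (map tm_code ts)))"
| "fm_code (Eql s t) = prod_encode (2, prod_encode (tm_code s, tm_code t))"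
| "fm_code (Imp \<phi> \<psi>) = prod_encode (3, prod_encode (fm_code \<phi>, fm_code \<psi>))"
| "fm_code (Forall x \<phi>) = prod_encode (4, prod_encode (x, fm_code \<phi>))"

lemma inj_tm_code: "inj tm_code"
proof (rule injI)
  show "s = t" if "tm_code s = tm_code t" for s t
    using that
  proof (induction s arbitrary: t)
    case (Var x)
    then show ?case by (cases t) auto
  next
    case (Fn f ts)
    then obtain us where t: "t = Fn f us" and "map tm_code ts = map tm_code us"
      by (cases t) (auto simp: list_encode_eq)
    then have "ts = us"
      using Fn.IH by (metis (no_types, lifting) list.inj_map_strong)
    then show ?case using t by simp
  qed
qed

lemma inj_fm_code: "inj fm_code"
proof (rule injI)
  show "\<phi> = \<psi>" if "fm_code \<phi> = fm_code \<psi>" for \<phi> \<psi>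
    using that
  proof (induction \<phi> arbitrary: \<psi>)
    case Bot
    then show ?case by (cases \<psi>) auto
  next
    case (Pre p ts)
    then show ?case
      by (cases \<psi>) (auto simp: list_encode_eq inj_tm_code inj_map_eq_map)
  next
    case (Eql s t)
    then show ?case by (cases \<psi>) (auto simp: inj_eq[OF inj_tm_code])
  next
    case (Imp \<phi>1 \<phi>2)
    then show ?case by (cases \<psi>) auto
  next
    case (Forall x \<phi>)
    then show ?case by (cases \<psi>) auto
  qed
qed

definition decidable_logic :: "language \<Rightarrow> bool" where
  "decidable_logic L \<longleftrightarrow> decidable_on fm_code (sentences L) (\<lambda>\<psi>. derives L {} \<psi>)"


section \<open>Theories and weighings\<close>

definition theory_of :: "language \<Rightarrow> fm set \<Rightarrow> bool" where
  "theory_of L T \<longleftrightarrow> T \<subseteq> sentences L"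

definition proves :: "language \<Rightarrow> fm set \<Rightarrow> fm set \<Rightarrow> bool" where
  "proves L T U \<longleftrightarrow> (\<forall>\<phi>\<in>U. derives L T \<phi>)"

definition equivalent :: "language \<Rightarrow> fm set \<Rightarrow> fm set \<Rightarrow> bool" where
  "equivalent L T U \<longleftrightarrow> proves L T U \<and> proves L U T"

text \<open>A weighing is a function \<open>fm set \<Rightarrow> real\<close>; only its values on theories of \<open>L\<close> matter.\<close>

definition HP :: "language \<Rightarrow> (fm set \<Rightarrow> real) \<Rightarrow> bool" where
  "HP L W \<longleftrightarrow> (\<forall>T U. theory_of L T \<longrightarrow> theory_of L U \<longrightarrow> W U > W T \<longrightarrow> \<not> proves L T U)"

definition EP :: "language \<Rightarrow> (fm set \<Rightarrow> real) \<Rightarrow> bool" where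
  "EP L W \<longleftrightarrow> (\<forall>T U. theory_of L T \<longrightarrow> theory_of L U \<longrightarrow> W T = W U \<longrightarrow> equivalent L T U)"

text \<open>A finite theory is given to an algorithm by the canonical index of its set of codes, and
  the output \<open>q\<close> is a code of the rational \<open>nat_to_rat_surj q\<close>.\<close>

definition computable_weighing :: "language \<Rightarrow> (fm set \<Rightarrow> real) \<Rightarrow> bool" where
  "computable_weighing L W \<longleftrightarrow>
     (\<exists>e. \<forall>T k. theory_of L T \<longrightarrow> finite T \<longrightarrow>
        (\<exists>q. eval e [set_encode (fm_code ` T), k] q \<and>
             \<bar>of_rat (nat_to_rat_surj q) - W T\<bar> \<le> 1 / 2 ^ k))"

end

theory Submission
  imports Defs
begin

text \<open>By HP and EP, a sentence \<open>\<psi>\<close> is provable iff \<open>W {\<psi>} = W {}\<close>.  If \<open>W\<close> is computable, then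
  unprovability is semidecidable: wait until approximations separate the two real numbers.
  Provability is semidecidable because the Hilbert calculus is an inductive definition with
  decidable rules.  Running both searches in parallel decides provability.\<close>

section \<open>Computable functions on numbers\<close>

text \<open>Approximations can refute the equality of two reals but never confirm it, so a
  computable \<open>W\<close> yields only the unprovable half; the provable half has to come from
  enumerating theorems. The program for \<open>W\<close> is promised to halt only on indices of
  finite theories of \<open>L\<close>. Computability is therefore relative to a set \<open>D\<close>
  of inputs, in the end the codes of sentences, and no program may be run outside its promise. On
  the logical side, programming syntax by recursion on codes is avoided: every rule is positive and
  uses finitely many premises, so the least fixed point is the union of a computable increasing
  sequence of finite stages.\<close>

abbreviation pr :: "nat \<Rightarrow> nat \<Rightarrow> nat" where "pr a b \<equiv> prod_encode (a, b)"
abbreviation pfst :: "nat \<Rightarrow> nat" where "pfst n \<equiv> fst (prod_decode n)"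
abbreviation psnd :: "nat \<Rightarrow> nat" where "psnd n \<equiv> snd (prod_decode n)"

section \<open>Evaluation of composite programs\<close>

lemma eval_Comp1:
  "eval g xs a \<Longrightarrow> eval f [a] z \<Longrightarrow> eval (Comp f [g]) xs z"
  by (rule eval.Comp[where ys = "[a]"]) auto

lemma eval_Comp2:
  "eval g xs a \<Longrightarrow> eval h xs b \<Longrightarrow> eval f [a, b] z \<Longrightarrow> eval (Comp f [g, h]) xs z"
  by (rule eval.Comp[where ys = "[a, b]"]) auto

lemma eval_Proj: "i < length xs \<Longrightarrow> y = xs ! i \<Longrightarrow> eval (Proj i) xs y"
  by (auto intro: eval.Proj)

text \<open>Separates running a program from computing its value: identifying the
  \<open>rec_nat\<close> term with a familiar function is left to an induction that mentions no
  programs.\<close>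

lemma eval_PrimRec:
  assumes "eval f xs a"
    and "\<And>i r. i < n \<Longrightarrow> eval g (i # r # xs) (b i r)"
  shows "eval (PrimRec f g) (n # xs) (rec_nat a b n)"
  using assms(2)
proof (induction n)
  case 0
  then show ?case using assms(1) by (auto intro: eval.PrimRec_0)
next
  case (Suc n)
  then show ?case by (auto intro!: eval.PrimRec_Suc)
qed

lemma eval_Mu_Least:
  assumes "\<And>i. eval f (i # xs) (g i)" and "\<exists>i. g i = 0"
  shows "eval (Mu f) xs (LEAST i. g i = 0)"
proof (rule eval.Mu)
  show "eval f ((LEAST i. g i = 0) # xs) 0"
    using assms LeastI_ex[of "\<lambda>i. g i = 0"] by metis
  show "\<forall>i<LEAST i. g i = 0. \<exists>y. eval f (i # xs) (Suc y)"
    using assms(1) not_less_Least[of _ "\<lambda>i. g i = 0"] by (metis not0_implies_Suc)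
qed

lemma eval_const: "\<exists>e. \<forall>xs. eval e xs c"
proof (induction c)
  case 0
  then show ?case by (blast intro: eval.Zero)
next
  case (Suc c)
  then show ?case by (blast intro: eval_Comp1 eval.Succ)
qed

section \<open>Programs for arithmetic and for the pairing function\<close>

lemma eval_add: "\<exists>e. \<forall>x y. eval e [x, y] (x + y)"
proof (intro exI allI)
  fix x y
  have "rec_nat y (\<lambda>_. Suc) x = x + y" by (induction x) auto
  moreover have "eval (PrimRec (Proj 0) (Comp Succ [Proj 1])) [x, y] (rec_nat y (\<lambda>_. Suc) x)"
    by (intro eval_PrimRec eval_Comp1[OF eval_Proj eval.Succ] eval_Proj) auto
  ultimately show "eval (PrimRec (Proj 0) (Comp Succ [Proj 1])) [x, y] (x + y)" by simp
qed

lemma eval_diff: "\<exists>e. \<forall>x y. eval e [x, y] (x - y)"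
proof (intro exI allI)
  let ?pred = "PrimRec Zero (Proj 0)"
  have pred: "eval ?pred [x] (x - 1)" for x
  proof -
    have "rec_nat 0 (\<lambda>i _. i) x = x - 1" by (cases x) auto
    moreover have "eval ?pred [x] (rec_nat 0 (\<lambda>i _. i) x)"
      by (intro eval_PrimRec eval_Proj eval.Zero) auto
    ultimately show ?thesis by simp
  qed
  fix x y
  have "rec_nat x (\<lambda>_ r. r - 1) y = x - y" by (induction y) auto
  moreover have "eval (PrimRec (Proj 0) (Comp ?pred [Proj 1])) [y, x] (rec_nat x (\<lambda>_ r. r - 1) y)"
    by (intro eval_PrimRec eval_Comp1[OF eval_Proj pred] eval_Proj) auto
  ultimately show "eval (Comp (PrimRec (Proj 0) (Comp ?pred [Proj 1])) [Proj 1, Proj 0]) [x, y] (x - y)"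
    by (auto intro!: eval_Comp2 eval_Proj)
qed

lemma eval_triangle: "\<exists>e. \<forall>x. eval e [x] (triangle x)"
proof -
  obtain add where add: "\<And>x y. eval add [x, y] (x + y)" using eval_add by blast
  have "eval (PrimRec Zero (Comp Succ [Comp add [Proj 0, Proj 1]])) [x] (triangle x)" for x
  proof -
    have "rec_nat 0 (\<lambda>i r. Suc (i + r)) x = triangle x" by (induction x) auto
    moreover have "eval (Comp Succ [Comp add [Proj 0, Proj 1]]) [i, r] (Suc (i + r))" for i r
      by (rule eval_Comp1[OF eval_Comp2[OF _ _ add] eval.Succ]) (auto intro: eval_Proj)
    ultimately show ?thesis
      using eval_PrimRec[of Zero "[]" 0 x "Comp Succ [Comp add [Proj 0, Proj 1]]" "\<lambda>i r. Suc (i + r)"]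
      by (auto intro: eval.Zero)
  qed
  then show ?thesis by blast
qed

lemma eval_prod_encode: "\<exists>e. \<forall>x y. eval e [x, y] (pr x y)"
proof -
  obtain add tri where add: "\<And>x y. eval add [x, y] (x + y)" and tri: "\<And>x. eval tri [x] (triangle x)"
    using eval_add eval_triangle by blast
  have "eval (Comp add [Comp tri [add], Proj 0]) [x, y] (pr x y)" for x y
    unfolding prod_encode_def prod.case
    by (rule eval_Comp2[OF eval_Comp1[OF add tri] _ add]) (auto intro: eval_Proj)
  then show ?thesis by blast
qed

lemma mono_triangle: "m \<le> n \<Longrightarrow> triangle m \<le> triangle n"
  by (induction n) (auto simp: le_Suc_eq)

text \<open>The code of \<open>(a, b)\<close> is \<open>triangle (a + b) + a\<close>, which lies
  below \<open>triangle (Suc (a + b))\<close>. With truncated subtraction the zero test says code <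
  \<open>triangle (Suc s)\<close>, so the search stops exactly at the diagonal \<open>a + b\<close>,
  from which both components are recovered by subtraction.\<close>

lemma Least_triangle_prod_encode: "(LEAST s. Suc (pr a b) - triangle (Suc s) = 0) = a + b"
proof (rule Least_equality)
  show "Suc (pr a b) - triangle (Suc (a + b)) = 0" by (simp add: prod_encode_def)
  fix s assume "Suc (pr a b) - triangle (Suc s) = 0"
  then have "\<not> Suc s \<le> a + b"
    using mono_triangle[of "Suc s" "a + b"] by (auto simp: prod_encode_def)
  then show "a + b \<le> s" by simp
qed

lemma eval_prod_decode:
  "\<exists>e. \<forall>x. eval e [x] (pfst x)" "\<exists>e. \<forall>x. eval e [x] (psnd x)"
proof -
  obtain sub tri where sub: "\<And>x y. eval sub [x, y] (x - y)" and tri: "\<And>x. eval tri [x] (triangle x)"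
    using eval_diff eval_triangle by blast
  let ?diag = "Mu (Comp sub [Comp Succ [Proj 1], Comp tri [Comp Succ [Proj 0]]])"
  have diag: "eval ?diag [x] (pfst x + psnd x)" for x
  proof -
    have L: "(LEAST s. Suc x - triangle (Suc s) = 0) = pfst x + psnd x"
      using Least_triangle_prod_encode[of "pfst x" "psnd x"] by simp
    have "pr (pfst x) (psnd x) < triangle (Suc (pfst x + psnd x))"
      unfolding prod_encode_def prod.case by simp
    then have "Suc x - triangle (Suc (pfst x + psnd x)) = 0" by simp
    then have "\<exists>s. Suc x - triangle (Suc s) = 0" by blast
    then show ?thesis
      unfolding L[symmetric]
      by (intro eval_Mu_Least eval_Comp2[OF eval_Comp1[OF _ eval.Succ]
            eval_Comp1[OF eval_Comp1[OF _ eval.Succ] tri] sub]) (auto intro: eval_Proj)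
  qed
  have pf: "pfst x = x - triangle (pfst x + psnd x)" for x
  proof -
    have "pfst x = pr (pfst x) (psnd x) - triangle (pfst x + psnd x)"
      unfolding prod_encode_def prod.case by simp
    then show ?thesis by simp
  qed
  let ?fst = "Comp sub [Proj 0, Comp tri [?diag]]"
  have 1: "eval ?fst [x] (pfst x)" for x
    by (subst pf) (rule eval_Comp2[OF _ eval_Comp1[OF diag tri] sub], auto intro: eval_Proj)
  have "eval (Comp sub [?diag, ?fst]) [x] (psnd x)" for x
    using eval_Comp2[OF diag 1 sub] by simp
  with 1 show "\<exists>e. \<forall>x. eval e [x] (pfst x)" "\<exists>e. \<forall>x. eval e [x] (psnd x)" by blast+
qed

text \<open>\<open>D\<close> is a promise on the input: outside it the program may diverge or return
  anything.\<close>

definition computable_on :: "nat set \<Rightarrow> (nat \<Rightarrow> nat) \<Rightarrow> bool" where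
  "computable_on D f \<longleftrightarrow> (\<exists>e. \<forall>x\<in>D. eval e [x] (f x))"

abbreviation computable :: "(nat \<Rightarrow> nat) \<Rightarrow> bool" where
  "computable \<equiv> computable_on UNIV"

abbreviation decidable :: "(nat \<Rightarrow> bool) \<Rightarrow> bool" where
  "decidable \<equiv> decidable_on id UNIV"

lemma computable_binary:
  assumes "\<exists>e. \<forall>x y. eval e [x, y] (h x y)" "computable_on D f" "computable_on D g"
  shows "computable_on D (\<lambda>x. h (f x) (g x))"
  using assms unfolding computable_on_def by (meson eval_Comp2)

lemma computable_unary:
  assumes "\<exists>e. \<forall>x. eval e [x] (h x)" "computable_on D f"
  shows "computable_on D (\<lambda>x. h (f x))"
  using assms unfolding computable_on_def by (meson eval_Comp1)

named_theorems comp_intros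

lemma computable_const [comp_intros]: "computable_on D (\<lambda>_. c)"
  using eval_const[of c] unfolding computable_on_def by blast

lemma computable_id [comp_intros]: "computable_on D (\<lambda>x. x)"
  unfolding computable_on_def by (rule exI[of _ "Proj 0"]) (auto intro: eval_Proj)

lemmas computable_add [comp_intros] = computable_binary[OF eval_add]
lemmas computable_diff [comp_intros] = computable_binary[OF eval_diff]
lemmas computable_pair [comp_intros] = computable_binary[OF eval_prod_encode]
lemmas computable_fst [comp_intros] = computable_unary[OF eval_prod_decode(1)]
lemmas computable_snd [comp_intros] = computable_unary[OF eval_prod_decode(2)]

lemma computable_compose:
  "computable g \<Longrightarrow> computable_on D f \<Longrightarrow> computable_on D (\<lambda>x. g (f x))"
  by (rule computable_unary) (auto simp: computable_on_def)

lemma computable_Suc [comp_intros]: "computable_on D f \<Longrightarrow> computable_on D (\<lambda>x. Suc (f x))"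
  using computable_add[of D f "\<lambda>_. 1"] by (simp add: computable_const)

lemma computable_rec_nat:
  assumes "computable_on D a"
    and "computable (\<lambda>p. b (pfst p) (pfst (psnd p)) (psnd (psnd p)))"
    and "computable_on D m"
  shows "computable_on D (\<lambda>x. rec_nat (a x) (\<lambda>i r. b i r x) (m x))"
proof -
  obtain ea eb em pair where a: "\<And>x. x \<in> D \<Longrightarrow> eval ea [x] (a x)"
    and b: "\<And>p. eval eb [p] (b (pfst p) (pfst (psnd p)) (psnd (psnd p)))"
    and m: "\<And>x. x \<in> D \<Longrightarrow> eval em [x] (m x)"
    and pair: "\<And>x y. eval pair [x, y] (pr x y)"
    using assms eval_prod_encode unfolding computable_on_def by blast
  \<comment> \<open>Primitive recursion passes three arguments, whereas computability is stated for
    unary programs; the arguments are packed into one number before \<open>eb\<close> is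
    called.\<close>
  let ?b = "Comp eb [Comp pair [Proj 0, Comp pair [Proj 1, Proj 2]]]"
  have "eval ?b [i, r, x] (b i r x)" for i r x
  proof (rule eval_Comp1)
    show "eval (Comp pair [Proj 0, Comp pair [Proj 1, Proj 2]]) [i, r, x] (pr i (pr r x))"
      by (intro eval_Comp2[OF _ _ pair]) (auto intro: eval_Proj)
    show "eval eb [pr i (pr r x)] (b i r x)" using b[of "pr i (pr r x)"] by simp
  qed
  then have "eval (PrimRec ea ?b) [m x, x] (rec_nat (a x) (\<lambda>i r. b i r x) (m x))" if "x \<in> D" for x
    by (intro eval_PrimRec a that)
  then have "eval (Comp (PrimRec ea ?b) [em, Proj 0]) [x] (rec_nat (a x) (\<lambda>i r. b i r x) (m x))"
    if "x \<in> D" for x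
    using that by (intro eval_Comp2[OF m]) (auto intro: eval_Proj)
  then show ?thesis unfolding computable_on_def by blast
qed

lemma computable_mult [comp_intros]:
  assumes "computable_on D f" "computable_on D g"
  shows "computable_on D (\<lambda>x. f x * g x)"
proof -
  have "computable (\<lambda>p. rec_nat 0 (\<lambda>_ r. r + psnd p) (pfst p))"
    by (rule computable_rec_nat; intro comp_intros)
  moreover have "rec_nat 0 (\<lambda>_ r. r + y) x = x * y" for x y :: nat by (induction x) auto
  ultimately have "computable (\<lambda>p. pfst p * psnd p)" by simp
  from computable_compose[OF this computable_pair[OF assms]] show ?thesis by simp
qed

lemma computable_power [comp_intros]:
  assumes "computable_on D f" "computable_on D g"
  shows "computable_on D (\<lambda>x. f x ^ g x)"
proof -
  have "computable (\<lambda>p. rec_nat 1 (\<lambda>_ r. pfst p * r) (psnd p))"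
    by (rule computable_rec_nat; intro comp_intros)
  moreover have "rec_nat 1 (\<lambda>_ r. x * r) y = x ^ y" for x y :: nat by (induction y) auto
  ultimately have "computable (\<lambda>p. pfst p ^ psnd p)" by simp
  from computable_compose[OF this computable_pair[OF assms]] show ?thesis by simp
qed

lemma decidable_on_iff: "decidable_on id D P \<longleftrightarrow> computable_on D (\<lambda>x. if P x then 1 else 0)"
  by (simp add: decidable_on_def computable_on_def)

lemma decidable_le [comp_intros]:
  assumes "computable_on D f" "computable_on D g"
  shows "decidable_on id D (\<lambda>x. f x \<le> g x)"
proof -
  \<comment> \<open>Truncated subtraction turns the comparison into a characteristic
    function.\<close>
  have "computable_on D (\<lambda>x. 1 - (f x - g x))" by (intro comp_intros assms)
  moreover have "1 - (f x - g x) = (if f x \<le> g x then 1 else 0)" for x by auto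
  ultimately show ?thesis unfolding decidable_on_iff by (simp only:)
qed

lemma decidable_not [comp_intros]:
  assumes "decidable_on id D P"
  shows "decidable_on id D (\<lambda>x. \<not> P x)"
proof -
  have "computable_on D (\<lambda>x. 1 - (if P x then 1 else 0))"
    by (intro comp_intros assms[unfolded decidable_on_iff])
  moreover have "1 - (if P x then 1 else 0) = (if \<not> P x then 1 else (0::nat))" for x by auto
  ultimately show ?thesis unfolding decidable_on_iff by (simp only:)
qed

lemma decidable_conj [comp_intros]:
  assumes "decidable_on id D P" "decidable_on id D Q"
  shows "decidable_on id D (\<lambda>x. P x \<and> Q x)"
proof -
  have "computable_on D (\<lambda>x. (if P x then 1 else 0) * (if Q x then 1 else 0))"
    by (intro comp_intros assms[unfolded decidable_on_iff])
  moreover have "(if P x then 1 else 0) * (if Q x then 1 else 0) = (if P x \<and> Q x then 1 else (0::nat))"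
    for x by auto
  ultimately show ?thesis unfolding decidable_on_iff by (simp only:)
qed

lemma decidable_disj [comp_intros]:
  assumes "decidable_on id D P" "decidable_on id D Q"
  shows "decidable_on id D (\<lambda>x. P x \<or> Q x)"
  using decidable_not[OF decidable_conj[OF assms[THEN decidable_not]]] by simp

lemma decidable_eq [comp_intros]:
  fixes f g :: "nat \<Rightarrow> nat"
  assumes "computable_on D f" "computable_on D g"
  shows "decidable_on id D (\<lambda>x. f x = g x)"
  unfolding order.eq_iff by (intro comp_intros assms)

lemma decidable_less [comp_intros]:
  fixes f g :: "nat \<Rightarrow> nat"
  assumes "computable_on D f" "computable_on D g"
  shows "decidable_on id D (\<lambda>x. f x < g x)"
  unfolding not_le[symmetric] by (intro comp_intros assms)

lemma decidable_const [comp_intros]: "decidable_on id D (\<lambda>_. b)"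
  unfolding decidable_on_iff by (rule computable_const)

lemma decidable_compose:
  "decidable P \<Longrightarrow> computable_on D f \<Longrightarrow> decidable_on id D (\<lambda>x. P (f x))"
  unfolding decidable_on_iff by (rule computable_compose)

lemma computable_if [comp_intros]:
  assumes "decidable_on id D P" "computable_on D f" "computable_on D g"
  shows "computable_on D (\<lambda>x. if P x then f x else g x)"
proof -
  \<comment> \<open>Selection is by multiplication with the 0/1 value of \<open>P\<close>;
    composition is strict, so both branches must be computable on all of \<open>D\<close>.\<close>
  have "computable_on D (\<lambda>x. (if P x then 1 else 0) * f x + (1 - (if P x then 1 else 0)) * g x)"
    by (intro comp_intros assms(2,3) assms(1)[unfolded decidable_on_iff])
  moreover have "(if P x then 1 else 0) * f x + (1 - (if P x then 1 else 0)) * g x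
      = (if P x then f x else g x)" for x by auto
  ultimately show ?thesis by (simp only:)
qed

text \<open>The search varies only the first component, so the promise on \<open>x\<close> holds for
  every call. \<open>Mu\<close> looks for a zero, which is why truth is recoded as 0.\<close>

lemma computable_Least:
  assumes "decidable_on id {p. psnd p \<in> D} (\<lambda>p. P (pfst p) (psnd p))"
    and "\<And>x. x \<in> D \<Longrightarrow> \<exists>n. P n x"
  shows "computable_on D (\<lambda>x. LEAST n. P n x)"
proof -
  have "computable_on {p. psnd p \<in> D} (\<lambda>p. if P (pfst p) (psnd p) then 0 else 1)"
    by (intro comp_intros assms)
  then obtain e pair where
    e: "\<And>p. psnd p \<in> D \<Longrightarrow> eval e [p] (if P (pfst p) (psnd p) then 0 else 1)"
    and pair: "\<And>x y. eval pair [x, y] (pr x y)"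
    using eval_prod_encode unfolding computable_on_def by blast
  have "eval (Mu (Comp e [pair])) [x] (LEAST n. P n x)" if x: "x \<in> D" for x
  proof -
    have "eval (Comp e [pair]) [n, x] (if P n x then 0 else 1)" for n
      using eval_Comp1[OF pair e[of "pr n x"]] x by simp
    moreover have "(if P n x then 0 else 1) = (0::nat) \<longleftrightarrow> P n x" for n by simp
    ultimately show ?thesis
      using eval_Mu_Least[of "Comp e [pair]" "[x]" "\<lambda>n. if P n x then 0 else 1"] assms(2)[OF x]
      by (simp only:)
  qed
  then show ?thesis unfolding computable_on_def by blast
qed

lemma computable_div [comp_intros]:
  assumes "computable_on D f" "computable_on D g"
  shows "computable_on D (\<lambda>x. f x div g x)"
proof -
  \<comment> \<open>The disjunct for a zero divisor stops the search at once with value 0, in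
    accordance with \<open>a div 0 = 0\<close>.\<close>
  have "computable (\<lambda>p. LEAST q. psnd p = 0 \<or> pfst p < psnd p * Suc q)"
  proof (rule computable_Least)
    show "decidable_on id {p. psnd p \<in> UNIV} (\<lambda>p. psnd (psnd p) = 0 \<or> pfst (psnd p) < psnd (psnd p) * Suc (pfst p))"
      by (intro comp_intros)
    show "\<exists>n. psnd x = 0 \<or> pfst x < psnd x * Suc n" for x
      by (metis dividend_less_times_div mult_Suc_right neq0_conv)
  qed
  moreover have "(LEAST q. b = 0 \<or> a < b * Suc q) = a div b" for a b :: nat
  proof (rule Least_equality)
    show "b = 0 \<or> a < b * Suc (a div b)"
      by (metis dividend_less_times_div mult_Suc_right neq0_conv)
    show "a div b \<le> q" if "b = 0 \<or> a < b * Suc q" for q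
      using that by (metis div_by_0 le0 less_Suc_eq_le less_mult_imp_div_less mult.commute)
  qed
  ultimately have "computable (\<lambda>p. pfst p div psnd p)" by simp
  from computable_compose[OF this computable_pair[OF assms]] show ?thesis by simp
qed

lemma decidable_even [comp_intros]:
  assumes "computable_on D f"
  shows "decidable_on id D (\<lambda>x. even (f x))"
proof -
  have "decidable_on id D (\<lambda>x. f x = f x div 2 * 2)" by (intro comp_intros assms)
  moreover have "n = n div 2 * 2 \<longleftrightarrow> even n" for n :: nat by (metis dvd_div_mult_self dvd_triv_right)
  ultimately show ?thesis by (simp only:)
qed

lemma decidable_set_decode [comp_intros]:
  assumes "computable_on D f" "computable_on D g"
  shows "decidable_on id D (\<lambda>x. f x \<in> set_decode (g x))"
  unfolding set_decode_def mem_Collect_eq by (intro comp_intros assms)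

text \<open>Adding \<open>2 ^ c\<close> sets bit \<open>c\<close> without a carry only when that bit
  is still 0, hence the guard.\<close>

lemma insert_set_decode:
  "set_decode (if c \<in> set_decode a then a else a + 2 ^ c) = insert c (set_decode a)"
proof (cases "c \<in> set_decode a")
  case False
  then have "set_encode (insert c (set_decode a)) = 2 ^ c + set_encode (set_decode a)"
    by (simp add: set_encode_insert)
  then show ?thesis using False
    by (metis add.commute finite_insert finite_set_decode set_decode_inverse set_encode_inverse)
qed auto

section \<open>Inductive predicates are semidecidable\<close>

text \<open>An enumeration operator has \<open>\<Phi> S x\<close> witnessed by a finite part of \<open>S\<close>, given by its canonical
  index \<open>a\<close>, and a number \<open>w\<close>.  Such operators are closed under the connectives that occur in
  the defining equation of an inductive predicate.\<close>

definition enumerates :: "(nat \<Rightarrow> nat \<Rightarrow> nat \<Rightarrow> bool) \<Rightarrow> ((nat \<Rightarrow> bool) \<Rightarrow> nat \<Rightarrow> bool) \<Rightarrow> bool" where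
  "enumerates R \<Phi> \<longleftrightarrow> decidable (\<lambda>p. R (pfst p) (pfst (psnd p)) (psnd (psnd p))) \<and>
     (\<forall>x a b w. set_decode a \<subseteq> set_decode b \<longrightarrow> R x a w \<longrightarrow> R x b w) \<and>
     (\<forall>S x. \<Phi> S x \<longleftrightarrow> (\<exists>a w. set_decode a \<subseteq> Collect S \<and> R x a w))"

definition enum_op :: "((nat \<Rightarrow> bool) \<Rightarrow> nat \<Rightarrow> bool) \<Rightarrow> bool" where
  "enum_op \<Phi> \<longleftrightarrow> (\<exists>R. enumerates R \<Phi>)"

lemma enumeratesD:
  assumes "enumerates R \<Phi>"
  shows "decidable (\<lambda>p. R (pfst p) (pfst (psnd p)) (psnd (psnd p)))"
    and "\<And>x a b w. set_decode a \<subseteq> set_decode b \<Longrightarrow> R x a w \<Longrightarrow> R x b w"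
    and "\<And>S x. \<Phi> S x \<longleftrightarrow> (\<exists>a w. set_decode a \<subseteq> Collect S \<and> R x a w)"
  using assms unfolding enumerates_def by blast+

lemma enum_opI:
  assumes "decidable (\<lambda>p. R (pfst p) (pfst (psnd p)) (psnd (psnd p)))"
    and "\<And>x a b w. set_decode a \<subseteq> set_decode b \<Longrightarrow> R x a w \<Longrightarrow> R x b w"
    and "\<And>S x. \<Phi> S x \<longleftrightarrow> (\<exists>a w. set_decode a \<subseteq> Collect S \<and> R x a w)"
  shows "enum_op \<Phi>"
  unfolding enum_op_def enumerates_def using assms by (intro exI[of _ R] conjI allI impI)

named_theorems enum_intros

section \<open>Closure properties of enumeration operators\<close>

lemma enum_op_decidable:
  assumes "decidable P"
  shows "enum_op (\<lambda>S x. P x)"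
  unfolding enum_op_def enumerates_def
proof (intro exI conjI)
  show "decidable (\<lambda>p. P (pfst p))" by (intro decidable_compose[OF assms] comp_intros)
qed (auto intro: exI[of _ 0])

lemma enum_op_eq [enum_intros]: "computable f \<Longrightarrow> computable g \<Longrightarrow> enum_op (\<lambda>S x. f x = g x)"
  by (intro enum_op_decidable comp_intros)

lemma enum_op_neq [enum_intros]: "computable f \<Longrightarrow> computable g \<Longrightarrow> enum_op (\<lambda>S x. f x \<noteq> g x)"
  by (intro enum_op_decidable comp_intros)

lemma enum_op_const [enum_intros]: "enum_op (\<lambda>S x. b)"
  by (intro enum_op_decidable comp_intros)

lemma enum_op_atom [enum_intros]:
  assumes "computable f"
  shows "enum_op (\<lambda>S x. S (f x))"
  unfolding enum_op_def enumerates_def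
proof (intro exI conjI allI)
  show "decidable (\<lambda>p. f (pfst p) \<in> set_decode (pfst (psnd p)))"
    by (intro comp_intros computable_compose[OF assms])
  show "S (f x) \<longleftrightarrow> (\<exists>a w. set_decode a \<subseteq> Collect S \<and> f x \<in> set_decode a)" for S x
    using set_encode_inverse[of "{f x}"] by (auto intro!: exI[of _ "set_encode {f x}"])
qed auto

text \<open>The two finite parts are united; the monotonicity clause of \<open>enumerates\<close>
  keeps both witnesses valid for the union.\<close>

lemma enum_op_conj [enum_intros]:
  assumes "enum_op \<Phi>" "enum_op \<Psi>"
  shows "enum_op (\<lambda>S x. \<Phi> S x \<and> \<Psi> S x)"
proof -
  obtain R where "enumerates R \<Phi>"
    using assms(1) unfolding enum_op_def by blast
  note R = enumeratesD[OF this]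
  obtain Q where "enumerates Q \<Psi>"
    using assms(2) unfolding enum_op_def by blast
  note Q = enumeratesD[OF this]
  let ?T = "\<lambda>x a w. R x a (pfst w) \<and> Q x a (psnd w)"
  have "computable (\<lambda>p. pr (pfst p) (pr (pfst (psnd p)) (pfst (psnd (psnd p)))))"
    "computable (\<lambda>p. pr (pfst p) (pr (pfst (psnd p)) (psnd (psnd (psnd p)))))"
    by (intro comp_intros)+
  from decidable_conj[OF decidable_compose[OF R(1) this(1)] decidable_compose[OF Q(1) this(2)]]
  have "decidable (\<lambda>p. ?T (pfst p) (pfst (psnd p)) (psnd (psnd p)))" by simp
  moreover have "\<Phi> S x \<and> \<Psi> S x \<longleftrightarrow> (\<exists>a w. set_decode a \<subseteq> Collect S \<and> ?T x a w)" for S x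
  proof
    assume "\<Phi> S x \<and> \<Psi> S x"
    then obtain a v b w where *: "set_decode a \<subseteq> Collect S" "R x a v" "set_decode b \<subseteq> Collect S" "Q x b w"
      using R(3) Q(3) by blast
    let ?c = "set_encode (set_decode a \<union> set_decode b)"
    have c: "set_decode ?c = set_decode a \<union> set_decode b"
      by (simp add: set_encode_inverse)
    then have "R x ?c v" "Q x ?c w" using R(2)[OF _ *(2)] Q(2)[OF _ *(4)] by blast+
    then have "set_decode ?c \<subseteq> Collect S \<and> ?T x ?c (pr v w)" using c * by simp
    then show "\<exists>a w. set_decode a \<subseteq> Collect S \<and> ?T x a w" by blast
  next
    assume "\<exists>a w. set_decode a \<subseteq> Collect S \<and> ?T x a w"
    then show "\<Phi> S x \<and> \<Psi> S x" unfolding R(3) Q(3) by blast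
  qed
  moreover have "?T x b w" if "set_decode a \<subseteq> set_decode b" "?T x a w" for x a b w
    using that R(2)[OF that(1)] Q(2)[OF that(1)] by simp
  ultimately show ?thesis by (intro enum_opI[of ?T])
qed

lemma enum_op_disj [enum_intros]:
  assumes "enum_op \<Phi>" "enum_op \<Psi>"
  shows "enum_op (\<lambda>S x. \<Phi> S x \<or> \<Psi> S x)"
proof -
  obtain R where "enumerates R \<Phi>"
    using assms(1) unfolding enum_op_def by blast
  note R = enumeratesD[OF this]
  obtain Q where "enumerates Q \<Psi>"
    using assms(2) unfolding enum_op_def by blast
  note Q = enumeratesD[OF this]
  show ?thesis
  proof (rule enum_opI)
    show "decidable (\<lambda>p. R (pfst p) (pfst (psnd p)) (psnd (psnd p)) \<or>
        Q (pfst p) (pfst (psnd p)) (psnd (psnd p)))"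
      by (intro comp_intros R(1) Q(1))
    show "R x b w \<or> Q x b w" if "set_decode a \<subseteq> set_decode b" "R x a w \<or> Q x a w" for x a b w
      using that(2) R(2)[OF that(1)] Q(2)[OF that(1)] by blast
  qed (simp only: R(3) Q(3), blast)
qed

text \<open>The bound variable is packed into the numeric argument in the premise, so nested
  quantifiers are peeled off one at a time; its value is later stored in the witness.\<close>

lemma enum_op_ex [enum_intros]:
  assumes "enum_op (\<lambda>S p. \<Phi> S (psnd p) (pfst p))"
  shows "enum_op (\<lambda>S x. \<exists>y. \<Phi> S x y)"
proof -
  obtain R where "enumerates R (\<lambda>S p. \<Phi> S (psnd p) (pfst p))"
    using assms unfolding enum_op_def by blast
  note R = enumeratesD[OF this]
  let ?T = "\<lambda>x a w. R (pr (pfst w) x) a (psnd w)"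
  have "computable (\<lambda>p. pr (pr (pfst (psnd (psnd p))) (pfst p)) (pr (pfst (psnd p)) (psnd (psnd (psnd p)))))"
    by (intro comp_intros)
  from decidable_compose[OF R(1) this]
  have "decidable (\<lambda>p. ?T (pfst p) (pfst (psnd p)) (psnd (psnd p)))" by simp
  moreover have "(\<exists>y. \<Phi> S x y) \<longleftrightarrow> (\<exists>a w. set_decode a \<subseteq> Collect S \<and> ?T x a w)" for S x
  proof
    assume "\<exists>y. \<Phi> S x y"
    then obtain y a w where "set_decode a \<subseteq> Collect S" "R (pr y x) a w"
      using R(3)[of S "pr _ x"] by auto
    then have "set_decode a \<subseteq> Collect S \<and> ?T x a (pr y w)" by simp
    then show "\<exists>a w. set_decode a \<subseteq> Collect S \<and> ?T x a w" by blast
  next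
    assume "\<exists>a w. set_decode a \<subseteq> Collect S \<and> ?T x a w"
    then obtain a w where "set_decode a \<subseteq> Collect S" "?T x a w" by blast
    then have "\<Phi> S x (pfst w)" using R(3)[of S "pr (pfst w) x"] by auto
    then show "\<exists>y. \<Phi> S x y" by blast
  qed
  moreover have "?T x b w" if "set_decode a \<subseteq> set_decode b" "?T x a w" for x a b w
    using R(2)[OF that] .
  ultimately show ?thesis by (intro enum_opI[of ?T])
qed

text \<open>Each application of the operator depends on finitely many earlier members, so a sequence
  of finite sets, computed one candidate at a time, exhausts the fixed point.\<close>

lemma enum_op_lfp:
  assumes "enum_op \<Phi>"
  shows "\<exists>R. decidable (\<lambda>p. R (pfst p) (psnd p)) \<and> (\<forall>x. lfp \<Phi> x \<longleftrightarrow> (\<exists>s. R s x))"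
proof -
  obtain R where "enumerates R \<Phi>"
    using assms unfolding enum_op_def by blast
  note R = enumeratesD[OF this]
  \<comment> \<open>A finite part of \<open>S\<close> is also a finite part of every larger
    predicate.\<close>
  have mono: "mono \<Phi>"
    using R(3) by (intro monoI le_funI) (simp add: le_fun_def le_bool_def, blast)
  \<comment> \<open>Stage \<open>s = pr x (pr w k)\<close> tries to add \<open>x\<close> with witness \<open>w\<close>; thanks to \<open>k\<close> every pair is
    tried at arbitrarily late stages, when the required finite part has been found.\<close>
  define step where "step s a = (if R (pfst s) a (pfst (psnd s))
    then if pfst s \<in> set_decode a then a else a + 2 ^ pfst s else a)" for s a
  define stage where "stage = rec_nat 0 step"
  have stage_Suc: "set_decode (stage (Suc s)) = (if R (pfst s) (stage s) (pfst (psnd s))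
    then insert (pfst s) (set_decode (stage s)) else set_decode (stage s))" for s
    by (simp add: stage_def step_def insert_set_decode)
  have "computable (\<lambda>p. pr (pfst (pfst p)) (pr (pfst (psnd p)) (pfst (psnd (pfst p)))))"
    by (intro comp_intros)
  from decidable_compose[OF R(1) this]
  have "decidable (\<lambda>p. R (pfst (pfst p)) (pfst (psnd p)) (pfst (psnd (pfst p))))" by simp
  then have "computable (\<lambda>s. rec_nat 0 (\<lambda>s a. step s a) s)"
    unfolding step_def by (intro computable_rec_nat[where b = "\<lambda>s a _. _ s a"] comp_intros)
  then have stage: "computable stage" by (simp add: stage_def)
  have stage_mono: "set_decode (stage s) \<subseteq> set_decode (stage t)" if "s \<le> t" for s t
    using that by (induction t) (auto simp: stage_Suc le_Suc_eq)
  have sound: "set_decode (stage s) \<subseteq> Collect (lfp \<Phi>)" for s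
  proof (induction s)
    case (Suc s)
    have "R x (stage s) w \<Longrightarrow> lfp \<Phi> x" for x w
      using Suc R(3) by (subst lfp_unfold[OF mono]) blast
    then show ?case using Suc by (auto simp: stage_Suc)
  qed (simp add: stage_def)
  let ?U = "\<lambda>x. \<exists>s. x \<in> set_decode (stage s)"
  \<comment> \<open>This compactness of the increasing stages is what makes their union closed under
    the operator.\<close>
  have bounded: "\<exists>s. A \<subseteq> set_decode (stage s)" if "finite A" "A \<subseteq> Collect ?U" for A
    using that
  proof (induction A)
    case (insert x A)
    then obtain s t where "A \<subseteq> set_decode (stage s)" "x \<in> set_decode (stage t)" by auto
    then have "insert x A \<subseteq> set_decode (stage (max s t))"
      using stage_mono[of s "max s t"] stage_mono[of t "max s t"] by auto
    then show ?case by blast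
  qed simp
  have "\<Phi> ?U \<le> ?U"
  proof (intro le_funI le_boolI)
    fix x assume "\<Phi> ?U x"
    then obtain a w where a: "set_decode a \<subseteq> Collect ?U" "R x a w" using R(3) by blast
    obtain s where s: "set_decode a \<subseteq> set_decode (stage s)" using bounded[OF _ a(1)] by auto
    let ?t = "pr x (pr w s)"
    have "s \<le> ?t" by (meson le_prod_encode_2 order.trans)
    then have "R x (stage ?t) w" using R(2)[OF _ a(2)] s stage_mono by blast
    then have "x \<in> set_decode (stage (Suc ?t))" by (simp add: stage_Suc)
    then show "?U x" by blast
  qed
  then have "lfp \<Phi> \<le> ?U" by (rule lfp_lowerbound)
  with sound have "lfp \<Phi> x \<longleftrightarrow> (\<exists>s. x \<in> set_decode (stage s))" for x
    by (auto simp: le_fun_def)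
  moreover have "decidable (\<lambda>p. psnd p \<in> set_decode (stage (pfst p)))"
    by (intro comp_intros computable_compose[OF stage])
  ultimately show ?thesis by (intro exI[of _ "\<lambda>s x. x \<in> set_decode (stage s)"]) simp
qed

section \<open>Semidecidability of provability\<close>

text \<open>These selectors let one set of rules serve both kinds of language: a propositional
  letter counts as a predicate symbol of arity 0.\<close>

fun function_symbols :: "language \<Rightarrow> (nat \<times> nat) set" where
  "function_symbols (Propositional A) = {}"
| "function_symbols (FirstOrder F P e) = F"

fun predicate_symbols :: "language \<Rightarrow> (nat \<times> nat) set" where
  "predicate_symbols (Propositional A) = A \<times> {0}"
| "predicate_symbols (FirstOrder F P e) = P"

fun has_equality :: "language \<Rightarrow> bool" where
  "has_equality (Propositional A) = False"
| "has_equality (FirstOrder F P e) = e"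

fun has_quantifiers :: "language \<Rightarrow> bool" where
  "has_quantifiers (Propositional A) = False"
| "has_quantifiers (FirstOrder F P e) = True"

text \<open>Constructors on bare numbers, mirroring \<open>tm_code\<close>, \<open>fm_code\<close>
  and \<open>list_encode\<close>, whose empty list is 0.\<close>

abbreviation cVar :: "nat \<Rightarrow> nat" where "cVar x \<equiv> pr 0 x"
abbreviation cFn :: "nat \<Rightarrow> nat \<Rightarrow> nat" where "cFn f l \<equiv> pr 1 (pr f l)"
abbreviation cCons :: "nat \<Rightarrow> nat \<Rightarrow> nat" where "cCons t l \<equiv> Suc (pr t l)"
abbreviation cBot :: nat where "cBot \<equiv> pr 0 0"
abbreviation cPre :: "nat \<Rightarrow> nat \<Rightarrow> nat" where "cPre p l \<equiv> pr 1 (pr p l)"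
abbreviation cEql :: "nat \<Rightarrow> nat \<Rightarrow> nat" where "cEql s t \<equiv> pr 2 (pr s t)"
abbreviation cImp :: "nat \<Rightarrow> nat \<Rightarrow> nat" where "cImp a b \<equiv> pr 3 (pr a b)"
abbreviation cForall :: "nat \<Rightarrow> nat \<Rightarrow> nat" where "cForall x a \<equiv> pr 4 (pr x a)"

text \<open>The leading tag distinguishes the kinds of judgement, so that kinds depending on one
  another share one fixed point. Non-occurrence is generated positively, because a monotone operator
  cannot refer to the failure of a judgement.\<close>

abbreviation jTerm :: "nat \<Rightarrow> nat" where "jTerm t \<equiv> pr 0 t"
abbreviation jTerms :: "nat \<Rightarrow> nat \<Rightarrow> nat" where "jTerms n l \<equiv> pr 1 (pr n l)"
abbreviation jForm :: "nat \<Rightarrow> nat" where "jForm a \<equiv> pr 2 a"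
abbreviation jNotInTm :: "nat \<Rightarrow> nat \<Rightarrow> nat" where "jNotInTm x t \<equiv> pr 3 (pr x t)"
abbreviation jNotInTms :: "nat \<Rightarrow> nat \<Rightarrow> nat" where "jNotInTms x l \<equiv> pr 4 (pr x l)"
abbreviation jNotFree :: "nat \<Rightarrow> nat \<Rightarrow> nat" where "jNotFree x a \<equiv> pr 5 (pr x a)"
abbreviation jSubstTm :: "nat \<Rightarrow> nat \<Rightarrow> nat \<Rightarrow> nat \<Rightarrow> nat" where
  "jSubstTm x s t t' \<equiv> pr 6 (pr x (pr s (pr t t')))"
abbreviation jSubstTms :: "nat \<Rightarrow> nat \<Rightarrow> nat \<Rightarrow> nat \<Rightarrow> nat" where
  "jSubstTms x s l l' \<equiv> pr 7 (pr x (pr s (pr l l')))"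
abbreviation jSubst :: "nat \<Rightarrow> nat \<Rightarrow> nat \<Rightarrow> nat \<Rightarrow> nat" where
  "jSubst x s a a' \<equiv> pr 8 (pr x (pr s (pr a a')))"
abbreviation jFreeFor :: "nat \<Rightarrow> nat \<Rightarrow> nat \<Rightarrow> nat" where
  "jFreeFor s x a \<equiv> pr 9 (pr s (pr x a))"
abbreviation jThm :: "nat \<Rightarrow> nat" where "jThm a \<equiv> pr 10 a"

text \<open>Derivability and all syntactic side conditions of the Hilbert calculus are generated by one
  inductive predicate on numbers, so that no recursion on codes has to be programmed.  The codes
  need not denote syntax: \<open>Subst\<close>, \<open>NotFree\<close> and \<open>FreeFor\<close> judgements may also hold of junk.\<close>

context notes [[inductive_internals]]
begin

inductive judgement :: "language \<Rightarrow> nat \<Rightarrow> bool" for L where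
  Term_Var: "judgement L (jTerm (cVar x))"
| Term_Fn: "(f, n) \<in> function_symbols L \<Longrightarrow> judgement L (jTerms n l) \<Longrightarrow> judgement L (jTerm (cFn f l))"
| Terms_Nil: "judgement L (jTerms 0 0)"
| Terms_Cons: "judgement L (jTerm t) \<Longrightarrow> judgement L (jTerms n l) \<Longrightarrow> judgement L (jTerms (Suc n) (cCons t l))"
| Form_Bot: "judgement L (jForm cBot)"
| Form_Pre: "(p, n) \<in> predicate_symbols L \<Longrightarrow> judgement L (jTerms n l) \<Longrightarrow> judgement L (jForm (cPre p l))"
| Form_Eql: "has_equality L \<Longrightarrow> judgement L (jTerm s) \<Longrightarrow> judgement L (jTerm t) \<Longrightarrow> judgement L (jForm (cEql s t))"
| Form_Imp: "judgement L (jForm a) \<Longrightarrow> judgement L (jForm b) \<Longrightarrow> judgement L (jForm (cImp a b))"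
| Form_Forall: "has_quantifiers L \<Longrightarrow> judgement L (jForm a) \<Longrightarrow> judgement L (jForm (cForall x a))"
| NotInTm_Var: "x \<noteq> y \<Longrightarrow> judgement L (jNotInTm x (cVar y))"
| NotInTm_Fn: "judgement L (jNotInTms x l) \<Longrightarrow> judgement L (jNotInTm x (cFn f l))"
| NotInTms_Nil: "judgement L (jNotInTms x 0)"
| NotInTms_Cons: "judgement L (jNotInTm x t) \<Longrightarrow> judgement L (jNotInTms x l) \<Longrightarrow> judgement L (jNotInTms x (cCons t l))"
| NotFree_Bot: "judgement L (jNotFree x cBot)"
| NotFree_Pre: "judgement L (jNotInTms x l) \<Longrightarrow> judgement L (jNotFree x (cPre p l))"
| NotFree_Eql: "judgement L (jNotInTm x s) \<Longrightarrow> judgement L (jNotInTm x t) \<Longrightarrow> judgement L (jNotFree x (cEql s t))"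
| NotFree_Imp: "judgement L (jNotFree x a) \<Longrightarrow> judgement L (jNotFree x b) \<Longrightarrow> judgement L (jNotFree x (cImp a b))"
| NotFree_Forall_same: "judgement L (jNotFree x (cForall x a))"
| NotFree_Forall: "judgement L (jNotFree x a) \<Longrightarrow> judgement L (jNotFree x (cForall y a))"
| SubstTm_Var_same: "judgement L (jTerm s) \<Longrightarrow> judgement L (jSubstTm x s (cVar x) s)"
| SubstTm_Var: "x \<noteq> y \<Longrightarrow> judgement L (jSubstTm x s (cVar y) (cVar y))"
| SubstTm_Fn: "judgement L (jSubstTms x s l l') \<Longrightarrow> judgement L (jSubstTm x s (cFn f l) (cFn f l'))"
| SubstTms_Nil: "judgement L (jSubstTms x s 0 0)"
| SubstTms_Cons: "judgement L (jSubstTm x s t t') \<Longrightarrow> judgement L (jSubstTms x s l l') \<Longrightarrow>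
    judgement L (jSubstTms x s (cCons t l) (cCons t' l'))"
| Subst_Bot: "judgement L (jSubst x s cBot cBot)"
| Subst_Pre: "judgement L (jSubstTms x s l l') \<Longrightarrow> judgement L (jSubst x s (cPre p l) (cPre p l'))"
| Subst_Eql: "judgement L (jSubstTm x s t t') \<Longrightarrow> judgement L (jSubstTm x s u u') \<Longrightarrow>
    judgement L (jSubst x s (cEql t u) (cEql t' u'))"
| Subst_Imp: "judgement L (jSubst x s a a') \<Longrightarrow> judgement L (jSubst x s b b') \<Longrightarrow>
    judgement L (jSubst x s (cImp a b) (cImp a' b'))"
| Subst_Forall_same: "judgement L (jSubst x s (cForall x a) (cForall x a))"
| Subst_Forall: "x \<noteq> y \<Longrightarrow> judgement L (jSubst x s a a') \<Longrightarrow>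
    judgement L (jSubst x s (cForall y a) (cForall y a'))"
| FreeFor_Bot: "judgement L (jFreeFor s x cBot)"
| FreeFor_Pre: "judgement L (jFreeFor s x (cPre p l))"
| FreeFor_Eql: "judgement L (jFreeFor s x (cEql t u))"
| FreeFor_Imp: "judgement L (jFreeFor s x a) \<Longrightarrow> judgement L (jFreeFor s x b) \<Longrightarrow> judgement L (jFreeFor s x (cImp a b))"
| FreeFor_Forall_not_free: "judgement L (jNotFree x (cForall y a)) \<Longrightarrow> judgement L (jFreeFor s x (cForall y a))"
| FreeFor_Forall: "judgement L (jNotInTm y s) \<Longrightarrow> judgement L (jFreeFor s x a) \<Longrightarrow> judgement L (jFreeFor s x (cForall y a))"
| Thm_K: "judgement L (jForm a) \<Longrightarrow> judgement L (jForm b) \<Longrightarrow> judgement L (jThm (cImp a (cImp b a)))"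
| Thm_S: "judgement L (jForm a) \<Longrightarrow> judgement L (jForm b) \<Longrightarrow> judgement L (jForm c) \<Longrightarrow>
    judgement L (jThm (cImp (cImp a (cImp b c)) (cImp (cImp a b) (cImp a c))))"
| Thm_DN: "judgement L (jForm a) \<Longrightarrow> judgement L (jThm (cImp (cImp (cImp a cBot) cBot) a))"
| Thm_Inst: "judgement L (jForm (cImp (cForall x a) b)) \<Longrightarrow> judgement L (jSubst x s a b) \<Longrightarrow>
    judgement L (jFreeFor s x a) \<Longrightarrow> judgement L (jThm (cImp (cForall x a) b))"
| Thm_Distr: "judgement L (jForm (cForall x (cImp a b))) \<Longrightarrow> judgement L (jNotFree x a) \<Longrightarrow>
    judgement L (jThm (cImp (cForall x (cImp a b)) (cImp a (cForall x b))))"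
| Thm_Refl: "judgement L (jForm (cEql t t)) \<Longrightarrow> judgement L (jThm (cEql t t))"
| Thm_Leibniz: "judgement L (jForm (cEql s t)) \<Longrightarrow> judgement L (jForm a) \<Longrightarrow>
    judgement L (jFreeFor s x a) \<Longrightarrow> judgement L (jFreeFor t x a) \<Longrightarrow>
    judgement L (jSubst x s a b) \<Longrightarrow> judgement L (jSubst x t a c) \<Longrightarrow> judgement L (jThm (cImp (cEql s t) (cImp b c)))"
| Thm_MP: "judgement L (jThm (cImp a b)) \<Longrightarrow> judgement L (jThm a) \<Longrightarrow> judgement L (jThm b)"
| Thm_Gen: "judgement L (jThm a) \<Longrightarrow> judgement L (jForm (cForall x a)) \<Longrightarrow> judgement L (jThm (cForall x a))"

end

lemma decidable_symbols:
  assumes "effectively_presented L"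
  shows "decidable (\<lambda>p. (pfst p, psnd p) \<in> function_symbols L)"
    and "decidable (\<lambda>p. (pfst p, psnd p) \<in> predicate_symbols L)"
proof -
  have *: "decidable (\<lambda>p. (pfst p, psnd p) \<in> F)" if F: "decidable_on prod_encode UNIV (\<lambda>s. s \<in> F)" for F
  proof -
    obtain e where e: "\<And>s. eval e [prod_encode s] (if s \<in> F then 1 else 0)"
      using F unfolding decidable_on_def by blast
    have "eval e [p] (if (pfst p, psnd p) \<in> F then 1 else 0)" for p
      using e[of "prod_decode p"] by simp
    then show ?thesis unfolding decidable_on_iff computable_on_def by blast
  qed
  have "decidable (\<lambda>p. (pfst p, psnd p) \<in> function_symbols L) \<and>
    decidable (\<lambda>p. (pfst p, psnd p) \<in> predicate_symbols L)"
  proof (cases L)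
    case (Propositional A)
    then have A: "decidable (\<lambda>p. p \<in> A)" using assms by simp
    have "decidable (\<lambda>p. pfst p \<in> A \<and> psnd p = 0)"
      by (intro comp_intros decidable_compose[OF A])
    then show ?thesis using Propositional by (simp add: decidable_const mem_Times_iff)
  qed (use assms * in auto)
  then show "decidable (\<lambda>p. (pfst p, psnd p) \<in> function_symbols L)"
    and "decidable (\<lambda>p. (pfst p, psnd p) \<in> predicate_symbols L)" by simp_all
qed

lemma enum_op_mem:
  assumes "decidable (\<lambda>p. (pfst p, psnd p) \<in> F)" "computable f" "computable g"
  shows "enum_op (\<lambda>S x. (f x, g x) \<in> F)"
  using decidable_compose[OF assms(1) computable_pair[OF assms(2,3)]]
  by (intro enum_op_decidable) simp

text \<open>\<open>judgement_def\<close>, exposed by \<open>inductive_internals\<close>, presents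
  the predicate as the \<open>lfp\<close> of a disjunction of existentially quantified conjunctions,
  one per rule; the closure rules follow exactly that shape.\<close>

lemma judgement_semidecidable:
  assumes "effectively_presented L"
  shows "\<exists>R. decidable (\<lambda>p. R (pfst p) (psnd p)) \<and> (\<forall>x. judgement L x \<longleftrightarrow> (\<exists>s. R s x))"
  unfolding judgement_def
  by (rule enum_op_lfp)
    (intro enum_intros comp_intros decidable_symbols[OF assms, THEN enum_op_mem])

section \<open>Soundness: decoding generated judgements into syntax\<close>

lemma is_formula_atoms:
  "is_formula L (Pre p ts) \<longleftrightarrow> (p, length ts) \<in> predicate_symbols L \<and> (\<forall>t\<in>set ts. is_term (function_symbols L) t)"
  "is_formula L (Eql s t) \<longleftrightarrow> has_equality L \<and> is_term (function_symbols L) s \<and> is_term (function_symbols L) t"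
  "is_formula L (Forall x \<phi>) \<longleftrightarrow> has_quantifiers L \<and> is_formula L \<phi>"
  by (cases L; auto)+

declare is_formula.simps(2,3,5) [simp del] is_formula_atoms [simp]

text \<open>Oriented as the equations arise in the soundness proof, where a code built by a rule is
  claimed to be the code of some term; the same holds for the two lemmas that follow.\<close>

lemma tm_code_inversion:
  "cVar x = tm_code t \<longleftrightarrow> t = Var x"
  "cFn f l = tm_code t \<longleftrightarrow> (\<exists>ts. t = Fn f ts \<and> l = list_encode (map tm_code ts))"
  by (cases t; auto)+

lemma list_code_inversion:
  "0 = list_encode (map tm_code ts) \<longleftrightarrow> ts = []"
  "cCons a l = list_encode (map tm_code ts) \<longleftrightarrow>
    (\<exists>u us. ts = u # us \<and> a = tm_code u \<and> l = list_encode (map tm_code us))"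
  by (cases ts; auto)+

lemma fm_code_inversion:
  "cBot = fm_code \<phi> \<longleftrightarrow> \<phi> = Bot"
  "cPre p l = fm_code \<phi> \<longleftrightarrow> (\<exists>ts. \<phi> = Pre p ts \<and> l = list_encode (map tm_code ts))"
  "cEql a b = fm_code \<phi> \<longleftrightarrow> (\<exists>s t. \<phi> = Eql s t \<and> a = tm_code s \<and> b = tm_code t)"
  "cImp a b = fm_code \<phi> \<longleftrightarrow> (\<exists>\<psi> \<chi>. \<phi> = Imp \<psi> \<chi> \<and> a = fm_code \<psi> \<and> b = fm_code \<chi>)"
  "cForall x a = fm_code \<phi> \<longleftrightarrow> (\<exists>\<psi>. \<phi> = Forall x \<psi> \<and> a = fm_code \<psi>)"
  by (cases \<phi>; auto)+

lemmas code_inversion = tm_code_inversion list_code_inversion fm_code_inversion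

text \<open>In \<open>Thm_Inst\<close> the number \<open>s\<close> may fail to code a term; it then stands for the arbitrary term
  \<open>inv tm_code s\<close>.  This is sound because \<open>SubstTm_Var_same\<close> and \<open>NotInTm\<close> force \<open>s\<close> to be a code
  whenever it matters.\<close>

definition valid :: "language \<Rightarrow> nat \<Rightarrow> bool" where
  "valid L j \<longleftrightarrow> (case prod_decode j of (k, a) \<Rightarrow>
    if k = 0 then \<exists>t. a = tm_code t \<and> is_term (function_symbols L) t
    else if k = 1 then case prod_decode a of (n, l) \<Rightarrow>
      \<exists>ts. l = list_encode (map tm_code ts) \<and> n = length ts \<and> (\<forall>t\<in>set ts. is_term (function_symbols L) t)
    else if k = 2 then \<exists>\<phi>. a = fm_code \<phi> \<and> is_formula L \<phi>
    else if k = 3 then case prod_decode a of (x, c) \<Rightarrow> \<exists>t. c = tm_code t \<and> x \<notin> fv_tm t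
    else if k = 4 then case prod_decode a of (x, l) \<Rightarrow>
      \<exists>ts. l = list_encode (map tm_code ts) \<and> (\<forall>t\<in>set ts. x \<notin> fv_tm t)
    else if k = 5 then case prod_decode a of (x, c) \<Rightarrow> \<forall>\<phi>. c = fm_code \<phi> \<longrightarrow> x \<notin> fv \<phi>
    else if k = 9 then case prod_decode a of (s, b) \<Rightarrow> case prod_decode b of (x, c) \<Rightarrow>
      \<forall>\<phi>. c = fm_code \<phi> \<longrightarrow> free_for (inv tm_code s) x \<phi>
    else if k = 10 then \<exists>\<phi>. a = fm_code \<phi> \<and> derives L {} \<phi>
    else case prod_decode a of (x, b) \<Rightarrow> case prod_decode b of (s, c) \<Rightarrow> case prod_decode c of (d, d') \<Rightarrow>
      if k = 6 then \<forall>t. d = tm_code t \<longrightarrow> d' = tm_code (subst_tm x (inv tm_code s) t)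
      else if k = 7 then \<forall>ts. d = list_encode (map tm_code ts) \<longrightarrow>
        d' = list_encode (map (\<lambda>t. tm_code (subst_tm x (inv tm_code s) t)) ts)
      else \<forall>\<phi>. d = fm_code \<phi> \<longrightarrow> d' = fm_code (subst x (inv tm_code s) \<phi>))"

lemma valid_simps:
  "valid L (jTerm a) \<longleftrightarrow> (\<exists>t. a = tm_code t \<and> is_term (function_symbols L) t)"
  "valid L (jTerms n l) \<longleftrightarrow>
    (\<exists>ts. l = list_encode (map tm_code ts) \<and> n = length ts \<and> (\<forall>t\<in>set ts. is_term (function_symbols L) t))"
  "valid L (jForm a) \<longleftrightarrow> (\<exists>\<phi>. a = fm_code \<phi> \<and> is_formula L \<phi>)"
  "valid L (jNotInTm x a) \<longleftrightarrow> (\<exists>t. a = tm_code t \<and> x \<notin> fv_tm t)"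
  "valid L (jNotInTms x l) \<longleftrightarrow> (\<exists>ts. l = list_encode (map tm_code ts) \<and> (\<forall>t\<in>set ts. x \<notin> fv_tm t))"
  "valid L (jNotFree x a) \<longleftrightarrow> (\<forall>\<phi>. a = fm_code \<phi> \<longrightarrow> x \<notin> fv \<phi>)"
  "valid L (jSubstTm x s a a') \<longleftrightarrow> (\<forall>t. a = tm_code t \<longrightarrow> a' = tm_code (subst_tm x (inv tm_code s) t))"
  "valid L (jSubstTms x s l l') \<longleftrightarrow> (\<forall>ts. l = list_encode (map tm_code ts) \<longrightarrow>
    l' = list_encode (map (\<lambda>t. tm_code (subst_tm x (inv tm_code s) t)) ts))"
  "valid L (jSubst x s a a') \<longleftrightarrow> (\<forall>\<phi>. a = fm_code \<phi> \<longrightarrow> a' = fm_code (subst x (inv tm_code s) \<phi>))"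
  "valid L (jFreeFor s x a) \<longleftrightarrow> (\<forall>\<phi>. a = fm_code \<phi> \<longrightarrow> free_for (inv tm_code s) x \<phi>)"
  "valid L (jThm a) \<longleftrightarrow> (\<exists>\<phi>. a = fm_code \<phi> \<and> derives L {} \<phi>)"
  by (simp_all add: valid_def)

lemma judgement_sound: "judgement L j \<Longrightarrow> valid L j"
proof (induction rule: judgement.induct)
  case (Thm_MP a b)
  \<comment> \<open>Injectivity of \<open>fm_code\<close> identifies the antecedent of the major
    premise with the minor premise.\<close>
  then obtain \<phi> \<psi> where "a = fm_code \<phi>" "b = fm_code \<psi>" "derives L {} (Imp \<phi> \<psi>)" "derives L {} \<phi>"
    unfolding valid_simps code_inversion by (auto simp: inj_eq[OF inj_fm_code])
  then show ?case unfolding valid_simps by (blast intro: derives.MP)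
qed (simp_all only: valid_simps code_inversion,
    auto simp: inv_f_f[OF inj_tm_code] inj_eq[OF inj_fm_code] inj_eq[OF inj_tm_code]
      list_encode_eq inj_map_eq_map[OF inj_tm_code] o_def
      intro: derives.K derives.S derives.DN derives.Inst[simplified] derives.Distr[simplified]
        derives.Refl[simplified] derives.Leibniz[simplified] derives.Gen[simplified])

section \<open>Completeness: every derivation is reflected by judgements\<close>

lemma judgement_terms:
  "(\<And>t. t \<in> set ts \<Longrightarrow> judgement L (jTerm (tm_code t))) \<Longrightarrow>
    judgement L (jTerms (length ts) (list_encode (map tm_code ts)))"
  \<comment> \<open>The simplifier turns the tag 1 into \<open>Suc 0\<close>, so the rules are
    unfolded to match.\<close>
  by (induction ts) (auto intro: judgement.intros[unfolded One_nat_def])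

lemma judgement_term: "is_term (function_symbols L) t \<Longrightarrow> judgement L (jTerm (tm_code t))"
  by (induction t) (auto intro: judgement.Term_Var judgement.Term_Fn[unfolded One_nat_def] judgement_terms[unfolded One_nat_def])

lemma judgement_formula: "is_formula L \<phi> \<Longrightarrow> judgement L (jForm (fm_code \<phi>))"
proof (induction \<phi>)
  case (Pre p ts)
  then have "judgement L (jTerms (length ts) (list_encode (map tm_code ts)))"
    by (intro judgement_terms judgement_term) auto
  then show ?case using Pre by (auto intro: judgement.Form_Pre[unfolded One_nat_def])
qed (auto intro: judgement.Form_Bot judgement.Form_Eql judgement.Form_Imp judgement.Form_Forall judgement_term)

lemma judgement_not_in_terms:
  "(\<And>t. t \<in> set ts \<Longrightarrow> judgement L (jNotInTm x (tm_code t))) \<Longrightarrow> judgement L (jNotInTms x (list_encode (map tm_code ts)))"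
  by (induction ts) (auto intro: judgement.NotInTms_Nil judgement.NotInTms_Cons)

lemma judgement_not_in_term: "x \<notin> fv_tm t \<Longrightarrow> judgement L (jNotInTm x (tm_code t))"
  by (induction t) (auto intro: judgement.NotInTm_Var judgement.NotInTm_Fn[unfolded One_nat_def] judgement_not_in_terms)

lemma judgement_not_free: "x \<notin> fv \<phi> \<Longrightarrow> judgement L (jNotFree x (fm_code \<phi>))"
proof (induction \<phi>)
  case (Pre p ts)
  then have "judgement L (jNotInTms x (list_encode (map tm_code ts)))"
    by (intro judgement_not_in_terms judgement_not_in_term) auto
  then show ?case by (auto intro: judgement.NotFree_Pre[unfolded One_nat_def])
next
  case (Forall y \<phi>)
  then show ?case by (cases "x = y") (auto intro: judgement.NotFree_Forall_same judgement.NotFree_Forall)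
qed (auto intro: judgement.NotFree_Bot judgement.NotFree_Eql judgement.NotFree_Imp judgement_not_in_term)

lemma judgement_subst_terms:
  "(\<And>t. t \<in> set ts \<Longrightarrow> judgement L (jSubstTm x s (tm_code t) (tm_code (subst_tm x u t)))) \<Longrightarrow>
    judgement L (jSubstTms x s (list_encode (map tm_code ts)) (list_encode (map tm_code (map (subst_tm x u) ts))))"
  by (induction ts) (auto intro: judgement.SubstTms_Nil judgement.SubstTms_Cons)

text \<open>The instance axiom does not require its term to belong to the language, whence the second
  alternative in the premise.\<close>

lemma judgement_subst_term:
  "is_term (function_symbols L) s \<or> is_term (function_symbols L) (subst_tm x s t) \<Longrightarrow>
    judgement L (jSubstTm x (tm_code s) (tm_code t) (tm_code (subst_tm x s t)))"
proof (induction t)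
  case (Var y)
  then show ?case using judgement.SubstTm_Var_same[OF judgement_term] judgement.SubstTm_Var by auto
next
  case (Fn f ts)
  then have "judgement L (jSubstTms x (tm_code s) (list_encode (map tm_code ts))
      (list_encode (map tm_code (map (subst_tm x s) ts))))"
    by (intro judgement_subst_terms) auto
  from judgement.SubstTm_Fn[OF this] show ?case by simp
qed

text \<open>\<open>Leibniz\<close> supplies the first alternative, since its equation is a formula;
  \<open>Inst\<close> supplies the second, since only the instance is known to be one.\<close>

lemma judgement_subst:
  "is_term (function_symbols L) s \<or> is_formula L (subst x s \<phi>) \<Longrightarrow>
    judgement L (jSubst x (tm_code s) (fm_code \<phi>) (fm_code (subst x s \<phi>)))"
proof (induction \<phi>)
  case (Pre p ts)
  then have "judgement L (jSubstTms x (tm_code s) (list_encode (map tm_code ts))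
      (list_encode (map tm_code (map (subst_tm x s) ts))))"
    by (intro judgement_subst_terms judgement_subst_term) auto
  from judgement.Subst_Pre[OF this] show ?case by simp
next
  case (Forall y \<phi>)
  then show ?case by (auto intro: judgement.Subst_Forall_same judgement.Subst_Forall)
qed (auto intro: judgement.Subst_Bot judgement.Subst_Eql judgement.Subst_Imp judgement_subst_term)

lemma judgement_free_for: "free_for s x \<phi> \<Longrightarrow> judgement L (jFreeFor (tm_code s) x (fm_code \<phi>))"
proof (induction \<phi>)
  case (Forall y \<phi>)
  then show ?case
    using judgement.FreeFor_Forall_not_free judgement_not_free[of x "Forall y \<phi>"] judgement.FreeFor_Forall judgement_not_in_term
    by fastforce
qed (auto intro: judgement.FreeFor_Bot judgement.FreeFor_Pre[unfolded One_nat_def] judgement.FreeFor_Eql judgement.FreeFor_Imp)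

lemma judgement_complete: "derives L {} \<phi> \<Longrightarrow> judgement L (jThm (fm_code \<phi>))"
proof (induction rule: derives.induct)
  case (K \<phi> \<psi>)
  then show ?case by (auto intro: judgement.Thm_K judgement_formula)
next
  case (S \<phi> \<psi> \<chi>)
  then show ?case by (auto intro: judgement.Thm_S judgement_formula)
next
  case (DN \<phi>)
  then show ?case by (auto intro: judgement.Thm_DN judgement_formula)
next
  case (Inst x \<phi> t)
  then show ?case
    using judgement.Thm_Inst[of L x "fm_code \<phi>" "fm_code (subst x t \<phi>)" "tm_code t"]
      judgement_formula[OF Inst(1)] judgement_subst[of L t x \<phi>] judgement_free_for by simp
next
  case (Distr x \<phi> \<psi>)
  then show ?case
    using judgement.Thm_Distr[of L x "fm_code \<phi>" "fm_code \<psi>"] judgement_formula[OF Distr(1)] judgement_not_free by simp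
next
  case (Refl t)
  then show ?case using judgement.Thm_Refl[of L "tm_code t"] judgement_formula[OF Refl] by simp
next
  case (Leibniz s t \<phi> x)
  then show ?case
    using judgement.Thm_Leibniz[of L "tm_code s" "tm_code t" "fm_code \<phi>" x] judgement_formula[OF Leibniz(1)]
      judgement_formula[OF Leibniz(2)] judgement_subst[of L _ x \<phi>] judgement_free_for by simp
next
  case (MP \<phi> \<psi>)
  then show ?case using judgement.Thm_MP[of L "fm_code \<phi>"] by simp
next
  case (Gen \<phi> x)
  then show ?case using judgement.Thm_Gen[of L "fm_code \<phi>" x] judgement_formula[OF Gen(2)] by simp
\<comment> \<open>The remaining case \<open>hyp\<close> is vacuous, the theory being empty.\<close>
qed simp

lemma derives_iff_judgement: "derives L {} \<phi> \<longleftrightarrow> judgement L (jThm (fm_code \<phi>))"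
  using judgement_complete judgement_sound[of L "jThm (fm_code \<phi>)"]
  by (auto simp only: valid_simps inj_eq[OF inj_fm_code])

section \<open>Comparison of coded rationals\<close>

text \<open>\<open>int_decode\<close> sends \<open>2 * m\<close> to \<open>m\<close> and
  \<open>2 * m + 1\<close> to \<open>- m - 1\<close>. Keeping positive and negative parts apart lets
  all computation stay in the natural numbers.\<close>

definition int_pos :: "nat \<Rightarrow> nat" where
  "int_pos n = (if even n then n div 2 else 0)"

definition int_neg :: "nat \<Rightarrow> nat" where
  "int_neg n = (if even n then 0 else Suc (n div 2))"

lemma int_decode_pos_neg: "int_decode n = int (int_pos n) - int (int_neg n)"
  by (simp add: int_decode_def sum_decode_def int_pos_def int_neg_def)

text \<open>For numerator \<open>A\<close> and denominator \<open>B\<close>, each a difference of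
  naturals, \<open>rat_pos\<close> and \<open>rat_neg\<close> collect the terms of either sign in
  the expanded product \<open>A * B\<close>.\<close>

definition rat_pos :: "nat \<Rightarrow> nat" where
  "rat_pos q = int_pos (pfst q) * int_pos (psnd q) + int_neg (pfst q) * int_neg (psnd q)"

definition rat_neg :: "nat \<Rightarrow> nat" where
  "rat_neg q = int_pos (pfst q) * int_neg (psnd q) + int_neg (pfst q) * int_pos (psnd q)"

text \<open>One of the two parts is 0, so the square of their sum is \<open>B ^ 2\<close>. If
  \<open>B = 0\<close>, the product \<open>A * B\<close> vanishes too, and the default 1 gives the
  quotient 0, the value of a fraction with denominator 0.\<close>

definition rat_den :: "nat \<Rightarrow> nat" where
  "rat_den q = (if psnd q = 0 then 1 else (int_pos (psnd q) + int_neg (psnd q)) ^ 2)"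

lemma computable_rat_parts [comp_intros]:
  assumes "computable_on D f"
  shows "computable_on D (\<lambda>x. rat_pos (f x))" "computable_on D (\<lambda>x. rat_neg (f x))"
    "computable_on D (\<lambda>x. rat_den (f x))"
  unfolding rat_pos_def rat_neg_def rat_den_def int_pos_def int_neg_def
  by (intro comp_intros assms)+

lemma rat_den_pos: "rat_den q > 0"
  by (auto simp: rat_den_def int_pos_def int_neg_def elim: evenE)

text \<open>Writing \<open>A / B\<close> as \<open>(A * B) / B\<^sup>2\<close> avoids a case distinction on the sign of the denominator.\<close>

lemma of_rat_nat_to_rat_surj:
  "real_of_rat (nat_to_rat_surj q) = (real (rat_pos q) - real (rat_neg q)) / real (rat_den q)"
proof -
  define A where "A = real (int_pos (pfst q)) - real (int_neg (pfst q))"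
  define B where "B = real (int_pos (psnd q)) - real (int_neg (psnd q))"
  have "real_of_rat (Fract a b) = real_of_int a / real_of_int b" for a b
    by (cases "b = 0") (simp_all add: of_rat_rat rat_number_collapse)
  then have 1: "real_of_rat (nat_to_rat_surj q) = A / B"
    by (simp add: nat_to_rat_surj_def A_def B_def int_decode_pos_neg split: prod.split)
  have 2: "real (rat_pos q) - real (rat_neg q) = A * B"
    by (simp add: rat_pos_def rat_neg_def A_def B_def algebra_simps)
  have 3: "B = 0 \<longleftrightarrow> psnd q = 0"
    by (auto simp: B_def int_pos_def int_neg_def elim: evenE intro: odd_pos)
  have "(real (int_pos b) + real (int_neg b))\<^sup>2 = (real (int_pos b) - real (int_neg b))\<^sup>2" for b
    by (simp add: int_pos_def int_neg_def power2_eq_square algebra_simps)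
  then have "real (rat_den q) = (if B = 0 then 1 else B\<^sup>2)"
    by (simp add: rat_den_def 3) (simp add: B_def)
  then show ?thesis unfolding 1 2 by (simp add: power2_eq_square)
qed

text \<open>Multiplying by \<open>2 ^ k\<close> and both positive denominators, and moving negative
  terms across, leaves comparisons of natural numbers, one for each sign of the difference.\<close>

lemma decidable_apart [comp_intros]:
  assumes "computable_on D f" "computable_on D g" "computable_on D k"
  shows "decidable_on id D (\<lambda>x.
    \<bar>real_of_rat (nat_to_rat_surj (f x)) - real_of_rat (nat_to_rat_surj (g x))\<bar> > 2 / 2 ^ k x)"
proof -
  have *: "2 / 2 ^ k < \<bar>real_of_rat (nat_to_rat_surj q) - real_of_rat (nat_to_rat_surj r)\<bar> \<longleftrightarrow>
    2 ^ k * (rat_neg q * rat_den r + rat_pos r * rat_den q) + 2 * (rat_den q * rat_den r)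
      < 2 ^ k * (rat_pos q * rat_den r + rat_neg r * rat_den q) \<or>
    2 ^ k * (rat_pos q * rat_den r + rat_neg r * rat_den q) + 2 * (rat_den q * rat_den r)
      < 2 ^ k * (rat_neg q * rat_den r + rat_pos r * rat_den q)" (is "_ \<longleftrightarrow> ?N + ?D < ?P \<or> ?P + ?D < ?N")
    for q r k
  proof -
    have den: "real (rat_den q) > 0" "real (rat_den r) > 0" using rat_den_pos by simp_all
    have "real_of_rat (nat_to_rat_surj q) - real_of_rat (nat_to_rat_surj r) =
        (real ?P - real ?N) / (2 ^ k * (real (rat_den q) * real (rat_den r)))"
      using den unfolding of_rat_nat_to_rat_surj by (simp add: field_simps)
    then have "2 / 2 ^ k < \<bar>real_of_rat (nat_to_rat_surj q) - real_of_rat (nat_to_rat_surj r)\<bar> \<longleftrightarrow>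
        2 / 2 ^ k < \<bar>real ?P - real ?N\<bar> / (2 ^ k * (real (rat_den q) * real (rat_den r)))"
      using den by (simp add: abs_divide)
    also have "\<dots> \<longleftrightarrow> real ?D < \<bar>real ?P - real ?N\<bar>"
      using den by (simp add: field_simps del: of_nat_add)
    also have "\<dots> \<longleftrightarrow> ?N + ?D < ?P \<or> ?P + ?D < ?N" by linarith
    finally show ?thesis .
  qed
  show ?thesis unfolding * by (intro comp_intros assms)
qed

section \<open>Weighings\<close>

text \<open>HP says that if \<open>T\<close> proves \<open>U\<close> then \<open>W U\<close> \<le>
  \<open>W T\<close>. A provable \<open>\<psi>\<close> makes \<open>{\<psi>}\<close> and
  \<open>{}\<close> prove each other, which forces equal weights; EP gives the converse.\<close>

lemma derives_iff_weight_eq: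
  assumes "HP L W" "EP L W" "\<psi> \<in> sentences L"
  shows "derives L {} \<psi> \<longleftrightarrow> W {\<psi>} = W {}"
proof
  assume "derives L {} \<psi>"
  then have "proves L {} {\<psi>}" "proves L {\<psi>} {}" by (simp_all add: proves_def)
  moreover have "theory_of L {\<psi>}" "theory_of L {}" using assms(3) by (simp_all add: theory_of_def)
  ultimately have "\<not> W {\<psi>} > W {}" "\<not> W {} > W {\<psi>}"
    using assms(1) unfolding HP_def by metis+
  then show "W {\<psi>} = W {}" by simp
next
  assume "W {\<psi>} = W {}"
  moreover have "theory_of L {\<psi>}" "theory_of L {}" using assms(3) by (simp_all add: theory_of_def)
  ultimately have "equivalent L {\<psi>} {}"
    using assms(2) unfolding EP_def by metis
  then show "derives L {} \<psi>" by (simp add: equivalent_def proves_def)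
qed

theorem theoremI3p9:
  fixes L :: language and W :: "fm set \<Rightarrow> real"
  assumes "effectively_presented L"
    and "\<not> decidable_logic L"
    and "HP L W"
    and "EP L W"
  shows "\<not> computable_weighing L W"
proof
  assume "computable_weighing L W"
  then obtain e where e: "\<And>T k. theory_of L T \<Longrightarrow> finite T \<Longrightarrow>
      \<exists>q. eval e [set_encode (fm_code ` T), k] q \<and> \<bar>real_of_rat (nat_to_rat_surj q) - W T\<bar> \<le> 1 / 2 ^ k"
    unfolding computable_weighing_def by blast
  \<comment> \<open>The hypothesis gives an output for each theory and precision separately; by
    determinism the chosen output is the accurate one.\<close>
  define q where "q n k = (SOME q. eval e [n, k] q)" for n k
  define r where "r n k = real_of_rat (nat_to_rat_surj (q n k))" for n k
  have q: "eval e [set_encode (fm_code ` T), k] (q (set_encode (fm_code ` T)) k)"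
    and r: "\<bar>r (set_encode (fm_code ` T)) k - W T\<bar> \<le> 1 / 2 ^ k" if T: "theory_of L T" "finite T" for T k
  proof -
    obtain y where y: "eval e [set_encode (fm_code ` T), k] y"
        "\<bar>real_of_rat (nat_to_rat_surj y) - W T\<bar> \<le> 1 / 2 ^ k"
      using e[OF T] by blast
    show *: "eval e [set_encode (fm_code ` T), k] (q (set_encode (fm_code ` T)) k)"
      unfolding q_def by (rule someI) (rule y)
    show "\<bar>r (set_encode (fm_code ` T)) k - W T\<bar> \<le> 1 / 2 ^ k"
      using y eval_deterministic[OF * y(1)] by (simp add: r_def)
  qed
  define D where "D = fm_code ` sentences L"
  have empty: "theory_of L {}" and singleton: "\<psi> \<in> sentences L \<Longrightarrow> theory_of L {\<psi>}" for \<psi>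
    by (simp_all add: theory_of_def)
  \<comment> \<open>The canonical index of a singleton \<open>{x}\<close> is \<open>2 ^ x\<close>,
    that of the empty set is 0.\<close>
  have comp_q: "computable_on {p. psnd p \<in> D} (\<lambda>p. q (2 ^ psnd p) (pfst p))"
    "computable_on {p. psnd p \<in> D} (\<lambda>p. q 0 (pfst p))"
  proof -
    obtain a b where a: "\<And>p. eval a [p] (2 ^ psnd p)" and b: "\<And>p. eval b [p] (pfst p)"
      using computable_power[OF computable_const computable_snd[OF computable_id], of UNIV 2]
        eval_prod_decode(1) unfolding computable_on_def by blast
    have "eval (Comp e [a, b]) [p] (q (2 ^ psnd p) (pfst p))" if "psnd p \<in> D" for p
      using that q[OF singleton] unfolding D_def
      by (intro eval_Comp2[OF a b]) (auto simp: set_encode_def)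
    moreover have "eval (Comp e [Zero, b]) [p] (q 0 (pfst p))" for p
      using q[OF empty] by (intro eval_Comp2[OF eval.Zero b]) simp
    ultimately show "computable_on {p. psnd p \<in> D} (\<lambda>p. q (2 ^ psnd p) (pfst p))"
      "computable_on {p. psnd p \<in> D} (\<lambda>p. q 0 (pfst p))"
      unfolding computable_on_def by blast+
  qed
  obtain R where R: "decidable (\<lambda>p. R (pfst p) (psnd p))" "\<And>j. judgement L j \<longleftrightarrow> (\<exists>s. R s j)"
    using judgement_semidecidable[OF assms(1)] by blast
  have dec_R: "decidable_on id S (\<lambda>x. R (f x) (g x))" if "computable_on S f" "computable_on S g" for S f g
    using decidable_compose[OF R(1) computable_pair[OF that]] by simp
  \<comment> \<open>Each approximation is off by at most \<open>1 / 2 ^ n\<close>, so a gap beyond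
    the sum of both errors certifies distinct weights.\<close>
  define apart where "apart n x \<longleftrightarrow> \<bar>r (2 ^ x) n - r 0 n\<bar> > 2 / 2 ^ n" for n x
  have apart_iff: "(\<exists>n. apart n (fm_code \<psi>)) \<longleftrightarrow> \<not> derives L {} \<psi>" if \<psi>: "\<psi> \<in> sentences L" for \<psi>
  proof -
    have r1: "\<bar>r (2 ^ fm_code \<psi>) n - W {\<psi>}\<bar> \<le> 1 / 2 ^ n" for n
      using r[OF singleton[OF \<psi>], of n] by (simp add: set_encode_def)
    have r0: "\<bar>r 0 n - W {}\<bar> \<le> 1 / 2 ^ n" for n
      using r[OF empty, of n] by simp
    have "(\<exists>n. apart n (fm_code \<psi>)) \<longleftrightarrow> W {\<psi>} \<noteq> W {}"
    proof
      assume "\<exists>n. apart n (fm_code \<psi>)"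
      then obtain n where "\<bar>r (2 ^ fm_code \<psi>) n - r 0 n\<bar> > 2 * (1 / 2 ^ n)" by (auto simp: apart_def)
      then show "W {\<psi>} \<noteq> W {}" using r1[of n] r0[of n] by linarith
    next
      assume "W {\<psi>} \<noteq> W {}"
      \<comment> \<open>Quarter of the gap: two units of \<open>1 / 2 ^ n\<close> are lost to the
        approximation errors and two more are the threshold in \<open>apart\<close>.\<close>
      then have "0 < \<bar>W {\<psi>} - W {}\<bar> / 4" by simp
      then obtain n where "(1 / 2) ^ n < \<bar>W {\<psi>} - W {}\<bar> / 4"
        using real_arch_pow_inv[of _ "1 / 2"] by fastforce
      moreover have "(1 / 2) ^ n = 1 / (2 ^ n :: real)" by (rule power_one_over)
      moreover have "\<bar>W {\<psi>} - W {}\<bar> \<le> \<bar>r (2 ^ fm_code \<psi>) n - r 0 n\<bar> + 1 / 2 ^ n + 1 / 2 ^ n"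
        using r1[of n] r0[of n] by linarith
      moreover have "2 / 2 ^ n = 1 / 2 ^ n + 1 / (2 ^ n :: real)" by simp
      ultimately have "apart n (fm_code \<psi>)" unfolding apart_def by argo
      then show "\<exists>n. apart n (fm_code \<psi>)" ..
    qed
    then show ?thesis using derives_iff_weight_eq[OF assms(3,4) \<psi>] by simp
  qed
  \<comment> \<open>A single index serves both as stage of the proof search and as precision, so one
    unbounded search runs both; each test halts, so neither search can block the other.\<close>
  define found where "found n x \<longleftrightarrow> R n (jThm x) \<or> apart n x" for n x
  have "decidable_on id {p. psnd p \<in> D} (\<lambda>p. found (pfst p) (psnd p))"
    unfolding found_def apart_def r_def by (intro comp_intros dec_R comp_q)
  moreover have ex: "\<exists>n. found n x" if "x \<in> D" for x
  proof -
    from that obtain \<psi> where "x = fm_code \<psi>" "\<psi> \<in> sentences L" unfolding D_def by blast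
    then show ?thesis
      using apart_iff[of \<psi>] derives_iff_judgement[of L \<psi>] R(2)[of "jThm x"] unfolding found_def by blast
  qed
  ultimately have "computable_on D (\<lambda>x. LEAST n. found n x)" by (rule computable_Least)
  \<comment> \<open>The search does not report which side succeeded, so \<open>R\<close> is tested
    once more at the index found. If it fails there, \<open>apart\<close> holds and excludes
    provability.\<close>
  then have "decidable_on id D (\<lambda>x. R (LEAST n. found n x) (jThm x))"
    by (intro dec_R comp_intros)
  moreover have "R (LEAST n. found n (fm_code \<psi>)) (jThm (fm_code \<psi>)) \<longleftrightarrow> derives L {} \<psi>"
    if \<psi>: "\<psi> \<in> sentences L" for \<psi>
  proof -
    have "found (LEAST n. found n (fm_code \<psi>)) (fm_code \<psi>)"
      by (rule LeastI_ex[OF ex]) (simp add: D_def \<psi>)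
    then show ?thesis
      using apart_iff[OF \<psi>] derives_iff_judgement[of L \<psi>] R(2)[of "jThm (fm_code \<psi>)"] unfolding found_def by blast
  qed
  ultimately have "decidable_logic L"
    unfolding decidable_logic_def decidable_on_def D_def by (simp cong: if_cong)
  with assms(2) show False ..
qed

end
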